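(* Let $(A,\cdot,\Delta_A)$ be an anti-flexible bialgebra and $V$ a vector space. Let there be given linear maps $\rightharpoonup:V\otimes A\to A$, $\leftharpoonup:A\otimes V\to A$, $\triangleleft:V\otimes A\to V$, $\triangleright:A\otimes V\to V$, $\sigma:V\otimes V\to A$, $\rho:V\to A\otimes V$, $\gamma:V\to V\otimes A$, $Q:V\to A\otimes A$, $\cdot_V:V\otimes V\to V$, $\Delta_V:V\to V\otimes V$ (an extending datum of $A$ by $V$ of type (II)). Consider on $A\oplus V$ the multiplication $$(a,x)(b,y)=\big(ab+x\rightharpoonup b+a\leftharpoonup y+\sigma(x,y),\ xy+x\triangleleft b+a\triangleright y\big)$$ and the comultiplication $$\Delta_E(a)=\Delta_A(a),\qquad \Delta_E(x)=\Delta_V(x)+\rho(x)+\gamma(x)+Q(x).$$ Then $A\oplus V$ with this multiplication and comultiplication (the unified biproduct $A_{\sigma}\#^{Q}V$) is an anti-flexible bialgebra if and only if the multiplication makes $A\oplus V$ an anti-flexible algebra, the comultiplication makes $A\oplus V$ an anti-flexible coalgebra, and the following hold for all $a,b\in A$, $x,y\in V$: (F1) $\rho(xy)+\tau\gamma(yx)=\sigma(y,x_2)\otimes x_1+(y\rightharpoonup x_{[1]})\otimes x_{[0]}+y_{[1]}\otimes y_{[0]}x+y_{\{2\}}\otimes(y_{\{1\}}\triangleright x)+\sigma(x_1,y)\otimes x_2+(x_{[-1]}\leftharpoonup y)\otimes x_{[0]}+y_{[-1]}\otimes xy_{[0]}+y_{\{1\}}\otimes(x\triangleleft y_{\{2\}})$;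 (F2) $\Delta_A(x\rightharpoonup b)+\tau\Delta_A(b\leftharpoonup x)+Q(x\triangleleft b)+\tau Q(b\triangleright x)=(b\leftharpoonup x_{[0]})\otimes x_{[-1]}+bx_{\{2\}}\otimes x_{\{1\}}+b_2\otimes(b_1\leftharpoonup x)+(x_{[0]}\rightharpoonup b)\otimes x_{[1]}+x_{\{1\}}b\otimes x_{\{2\}}+b_1\otimes(x\rightharpoonup b_2)$; (F3) $\Delta_V(a\triangleright y)+\tau\Delta_V(y\triangleleft a)=y_2\otimes(y_1\triangleleft a)+y_1\otimes(a\triangleright y_2)$; (F4) $\Delta_A(\sigma(x,y))+\tau\Delta_A(\sigma(y,x))+Q(xy)+\tau Q(yx)=(y\rightharpoonup x_{\{2\}})\otimes x_{\{1\}}+\sigma(y,x_{[0]})\otimes x_{[-1]}+y_{[1]}\otimes\sigma(y_{[0]},x)+y_{\{2\}}\otimes(y_{\{1\}}\leftharpoonup x)+\sigma(x_{[0]},y)\otimes x_{[1]}+(x_{\{1\}}\leftharpoonup y)\otimes x_{\{2\}}+y_{[-1]}\otimes\sigma(x,y_{[0]})+y_{\{1\}}\otimes(x\rightharpoonup y_{\{2\}})$; (F5) $\gamma(x\triangleleft b)+\tau\rho(b\triangleright x)=(b\triangleright x_{[0]})\otimes x_{[-1]}+(x_{[0]}\triangleleft b)\otimes x_{[1]}$; (F6) $\rho(x\triangleleft b)+\tau\gamma(b\triangleright x)=(b\leftharpoonup x_2)\otimes x_1+bx_{[1]}\otimes x_{[0]}+b_2\otimes(b_1\triangleright x)+(x_1\rightharpoonup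 b)\otimes x_2+x_{[-1]}b\otimes x_{[0]}+b_1\otimes(x\triangleleft b_2)$; (F7) $x_1\otimes(x_2\rightharpoonup b)+x_{[0]}\otimes x_{[1]}b+(x\triangleleft b_1)\otimes b_2-(b\triangleright x_{[0]})\otimes x_{[1]}=\tau\big(x_{[-1]}\otimes(x_{[0]}\triangleleft b)-b_1\otimes(b_2\triangleright x)-(b\leftharpoonup x_1)\otimes x_2-bx_{[-1]}\otimes x_{[0]}\big)$; (F8) $(\mathrm{id}-\tau)(x_1\otimes(x_2\triangleleft b)-(b\triangleright x_1)\otimes x_2)=0$; (F9) $x_1\otimes\sigma(x_2,y)+x_{[0]}\otimes(x_{[1]}\leftharpoonup y)+xy_{[0]}\otimes y_{[1]}+(x\triangleleft y_{\{1\}})\otimes y_{\{2\}}-y_1\otimes\sigma(y_2,x)-y_{[0]}\otimes(y_{[1]}\leftharpoonup x)-yx_{[0]}\otimes x_{[1]}-(y\triangleleft x_{\{1\}})\otimes x_{\{2\}}=\tau\big(x_{[-1]}\otimes x_{[0]}y+x_{\{1\}}\otimes(x_{\{2\}}\triangleright y)+\sigma(x,y_1)\otimes y_2+(x\rightharpoonup y_{[-1]})\otimes y_{[0]}-y_{[-1]}\otimes y_{[0]}x-y_{\{1\}}\otimes(y_{\{2\}}\triangleright x)-\sigma(y,x_1)\otimes x_2-(y\rightharpoonup x_{[-1]})\otimes x_{[0]}\big)$; (F10) $(\mathrm{id}-\tau)(x_{[-1]}\otimes(x_{[0]}\rightharpoonup b)+x_{\{1\}}\otimes x_{\{2\}}b+(x\rightharpoonup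 b_1)\otimes b_2)=(\mathrm{id}-\tau)(b_1\otimes(b_2\leftharpoonup x)+(b\leftharpoonup x_{[0]})\otimes x_{[1]}+bx_{\{1\}}\otimes x_{\{2\}})$; (F11) $(\mathrm{id}-\tau)(x_{[-1]}\otimes\sigma(x_{[0]},y)+x_{\{1\}}\otimes(x_{\{2\}}\leftharpoonup y)+\sigma(x,y_{[0]})\otimes y_{[1]}+(x\rightharpoonup y_{\{1\}})\otimes y_{\{2\}})=(\mathrm{id}-\tau)(y_{[-1]}\otimes\sigma(y_{[0]},x)+y_{\{1\}}\otimes(y_{\{2\}}\leftharpoonup x)+\sigma(y,x_{[0]})\otimes x_{[1]}+(y\rightharpoonup x_{\{1\}})\otimes x_{\{2\}})$; (F12) $\Delta_V(xy)+\tau\Delta_V(yx)=yx_2\otimes x_1+y_2\otimes y_1x+x_1y\otimes x_2+y_1\otimes xy_2+(y\triangleleft x_{[1]})\otimes x_{[0]}+y_{[0]}\otimes(y_{[-1]}\triangleright x)+(x_{[-1]}\triangleright y)\otimes x_{[0]}+y_{[0]}\otimes(x\triangleleft y_{[1]})$; (F13) $(\mathrm{id}-\tau)(x_1\otimes x_2y+xy_1\otimes y_2-y_1\otimes y_2x-yx_1\otimes x_2)+(\mathrm{id}-\tau)(x_{[0]}\otimes(x_{[1]}\triangleright y)+(x\triangleleft y_{[-1]})\otimes y_{[0]}-y_{[0]}\otimes(y_{[1]}\triangleright x)-(y\triangleleft x_{[-1]})\otimes x_{[0]})=0$. Conversely, if $E$ is a vector space containing $A$ as a subspace with complement $V$,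 then any anti-flexible bialgebra structure on $E$ for which the canonical injection $i:A\to E$ is both an anti-flexible algebra homomorphism and an anti-flexible coalgebra homomorphism is of this form.
   Context: Vector spaces are over a fixed field of characteristic zero; $\tau(u\otimes v)=v\otimes u$, $\tau_{13}(u\otimes v\otimes w)=w\otimes v\otimes u$. Sigma notation: $\Delta_A(a)=a_1\otimes a_2$, $\Delta_V(x)=x_1\otimes x_2$, $\rho(x)=x_{[-1]}\otimes x_{[0]}$, $\gamma(x)=x_{[0]}\otimes x_{[1]}$, $Q(x)=x_{\{1\}}\otimes x_{\{2\}}$; $xy=x\cdot_Vy$ for $x,y\in V$. Anti-flexible algebra: bilinear product with $(ab)c-a(bc)=(cb)a-c(ba)$. Anti-flexible coalgebra: linear $\Delta$ with $T=\tau_{13}T$, $T=(\Delta\otimes\mathrm{id})\Delta-(\mathrm{id}\otimes\Delta)\Delta$. Anti-flexible bialgebra: both, with $\Delta(ab)+\tau\Delta(ba)=a_1b\otimes a_2+ba_2\otimes a_1+b_1\otimes ab_2+b_2\otimes b_1a$ and $(\mathrm{id}-\tau)(a_1\otimes a_2b+ab_1\otimes b_2-ba_1\otimes a_2-b_1\otimes b_2a)=0$ for all $a,b$. *)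

theory Defs
  imports Complex_Main "HOL-Library.Function_Algebras" "HOL-Library.Product_Plus"
begin

section \<open>Tensor products of vector spaces\<close>

text \<open>
  A vector space over \<open>'k\<close> is a type \<open>'a :: ab_group_add\<close> together with a scalar multiplication
  satisfying \<^const>\<open>vector_space\<close>; a linear map out of a tensor product is given as the
  corresponding bilinear function.

  The tensor product of two spaces is realised inside the functionals on
  \<open>'a \<Rightarrow> 'b \<Rightarrow> 'k\<close>: the pure tensor \<open>u \<otimes> v\<close> is evaluation of bilinear forms at \<open>(u, v)\<close>, and the tensor
  product is the span of the pure tensors. That this is the tensor product is
  \<open>tensor_space_universal\<close> below.
\<close>

definition bilin :: "('k::field \<Rightarrow> 'a::ab_group_add \<Rightarrow> 'a) \<Rightarrow> ('k \<Rightarrow> 'b::ab_group_add \<Rightarrow> 'b)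
    \<Rightarrow> ('k \<Rightarrow> 'c::ab_group_add \<Rightarrow> 'c) \<Rightarrow> ('a \<Rightarrow> 'b \<Rightarrow> 'c) \<Rightarrow> bool" where
  "bilin s1 s2 s3 f \<longleftrightarrow>
     (\<forall>y. Vector_Spaces.linear s1 s3 (\<lambda>x. f x y)) \<and> (\<forall>x. Vector_Spaces.linear s2 s3 (\<lambda>y. f x y))"

definition trilin :: "('k::field \<Rightarrow> 'a::ab_group_add \<Rightarrow> 'a) \<Rightarrow> ('k \<Rightarrow> 'c::ab_group_add \<Rightarrow> 'c)
    \<Rightarrow> ('a \<Rightarrow> 'a \<Rightarrow> 'a \<Rightarrow> 'c) \<Rightarrow> bool" where
  "trilin s s3 f \<longleftrightarrow>
     (\<forall>y z. Vector_Spaces.linear s s3 (\<lambda>x. f x y z)) \<and>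
     (\<forall>x z. Vector_Spaces.linear s s3 (\<lambda>y. f x y z)) \<and>
     (\<forall>x y. Vector_Spaces.linear s s3 (\<lambda>z. f x y z))"

definition fun_scale :: "'k::field \<Rightarrow> ('b \<Rightarrow> 'k) \<Rightarrow> 'b \<Rightarrow> 'k" where
  "fun_scale c f = (\<lambda>x. c * f x)"

type_synonym ('k, 'a, 'b) tensor = "('a \<Rightarrow> 'b \<Rightarrow> 'k) \<Rightarrow> 'k"
type_synonym ('k, 'a) tensor3 = "('a \<Rightarrow> 'a \<Rightarrow> 'a \<Rightarrow> 'k) \<Rightarrow> 'k"

definition tens :: "('k::field \<Rightarrow> 'a::ab_group_add \<Rightarrow> 'a) \<Rightarrow> ('k \<Rightarrow> 'b::ab_group_add \<Rightarrow> 'b)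
    \<Rightarrow> 'a \<Rightarrow> 'b \<Rightarrow> ('k, 'a, 'b) tensor" where
  "tens s1 s2 u v = (\<lambda>B. if bilin s1 s2 (*) B then B u v else 0)"

definition tensor_space :: "('k::field \<Rightarrow> 'a::ab_group_add \<Rightarrow> 'a) \<Rightarrow> ('k \<Rightarrow> 'b::ab_group_add \<Rightarrow> 'b)
    \<Rightarrow> ('k, 'a, 'b) tensor set" where
  "tensor_space s1 s2 = module.span fun_scale {tens s1 s2 u v | u v. True}"

definition tens3 :: "('k::field \<Rightarrow> 'a::ab_group_add \<Rightarrow> 'a) \<Rightarrow> 'a \<Rightarrow> 'a \<Rightarrow> 'a \<Rightarrow> ('k, 'a) tensor3" where
  "tens3 s u v w = (\<lambda>B. if trilin s (*) B then B u v w else 0)"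

text \<open>
  Sigma notation: for \<open>t = t\<^sub>1 \<otimes> t\<^sub>2\<close> (implicit sum) and bilinear \<open>F\<close>, \<open>sw t F\<close> is \<open>F t\<^sub>1 t\<^sub>2\<close>, the image
  of \<open>t\<close> under the linear map induced by \<open>F\<close>; see \<open>sw_tens\<close> and \<open>sw_linear\<close> below.
\<close>

definition sw :: "('k, 'a, 'b) tensor \<Rightarrow> ('a \<Rightarrow> 'b \<Rightarrow> 'w \<Rightarrow> 'k) \<Rightarrow> 'w \<Rightarrow> 'k" where
  "sw t F = (\<lambda>B. t (\<lambda>u v. F u v B))"

definition tau :: "('k, 'a, 'b) tensor \<Rightarrow> ('k, 'b, 'a) tensor" where
  "tau t = (\<lambda>B. t (\<lambda>u v. B v u))"

definition tau13 :: "('k, 'a) tensor3 \<Rightarrow> ('k, 'a) tensor3" where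
  "tau13 t = (\<lambda>B. t (\<lambda>u v w. B w v u))"

definition tmap :: "('k::field \<Rightarrow> 'c::ab_group_add \<Rightarrow> 'c) \<Rightarrow> ('k \<Rightarrow> 'd::ab_group_add \<Rightarrow> 'd)
    \<Rightarrow> ('a \<Rightarrow> 'c) \<Rightarrow> ('b \<Rightarrow> 'd) \<Rightarrow> ('k, 'a, 'b) tensor \<Rightarrow> ('k, 'c, 'd) tensor" where
  "tmap s1 s2 f g t = sw t (\<lambda>u v. tens s1 s2 (f u) (g v))"

definition linear_to_tensor :: "('k::field \<Rightarrow> 'c::ab_group_add \<Rightarrow> 'c) \<Rightarrow> ('k \<Rightarrow> 'a::ab_group_add \<Rightarrow> 'a)
    \<Rightarrow> ('k \<Rightarrow> 'b::ab_group_add \<Rightarrow> 'b) \<Rightarrow> ('c \<Rightarrow> ('k, 'a, 'b) tensor) \<Rightarrow> bool" where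
  "linear_to_tensor s s1 s2 f \<longleftrightarrow>
     Vector_Spaces.linear s fun_scale f \<and> (\<forall>x. f x \<in> tensor_space s1 s2)"


subsection \<open>Adequacy of the model\<close>

lemma vector_space_fun_scale: "vector_space (fun_scale :: 'k::field \<Rightarrow> ('b \<Rightarrow> 'k) \<Rightarrow> 'b \<Rightarrow> 'k)"
  by unfold_locales (auto simp: fun_scale_def fun_eq_iff algebra_simps)

lemma vector_space_mult: "vector_space ((*) :: 'k::field \<Rightarrow> 'k \<Rightarrow> 'k)"
  by unfold_locales (auto simp: algebra_simps)

lemma linear_form_comp:
  assumes "Vector_Spaces.linear s1 s2 f" "Vector_Spaces.linear s2 s3 g"
  shows "Vector_Spaces.linear s1 s3 (\<lambda>x. g (f x))"
  using Vector_Spaces.linear_compose[OF assms] by (simp add: comp_def)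

lemma linear_form_separates:
  assumes "vector_space s" and "\<And>\<phi>. Vector_Spaces.linear s ((*) :: 'k::field \<Rightarrow> 'k \<Rightarrow> 'k) \<phi> \<Longrightarrow> \<phi> w = 0"
  shows "w = 0"
proof (rule ccontr)
  assume "w \<noteq> 0"
  interpret vector_space_pair s "(*) :: 'k \<Rightarrow> 'k \<Rightarrow> 'k"
    using assms(1) vector_space_mult by (rule vector_space_pair.intro)
  have ind: "vs1.independent {w}" using \<open>w \<noteq> 0\<close> by simp
  have "construct {w} (\<lambda>_. 1) w = 1" by (rule construct_basis[OF ind]) simp
  moreover have "construct {w} (\<lambda>_. 1) w = 0" by (rule assms(2)[OF linear_construct[OF ind]])
  ultimately show False by simp
qed

lemma linear_extension:
  assumes "vector_space s1" and "vector_space s2"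
    and ext: "\<And>\<phi>. Vector_Spaces.linear s2 ((*) :: 'k::field \<Rightarrow> 'k \<Rightarrow> 'k) \<phi> \<Longrightarrow>
          \<exists>\<psi>. Vector_Spaces.linear s1 (*) \<psi> \<and> (\<forall>i. \<psi> (g i) = \<phi> (w i))"
  shows "\<exists>f. Vector_Spaces.linear s1 s2 f \<and> (\<forall>i. f (g i) = w i)"
proof -
  interpret vector_space_pair s1 s2 using assms(1,2) by (rule vector_space_pair.intro)
  obtain Bs where Bs: "Bs \<subseteq> range g" "vs1.independent Bs" "range g \<subseteq> vs1.span Bs"
    using vs1.maximal_independent_subset[of "range g"] by blast
  define f where "f = construct Bs (\<lambda>b. w (inv g b))"
  have lin: "Vector_Spaces.linear s1 s2 f" unfolding f_def by (rule linear_construct[OF Bs(2)])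
  have "f (g i) = w i" for i
  proof -
    have "f (g i) - w i = 0"
    proof (rule linear_form_separates[OF assms(2)])
      fix \<phi> assume \<phi>: "Vector_Spaces.linear s2 ((*) :: 'k \<Rightarrow> 'k \<Rightarrow> 'k) \<phi>"
      then obtain \<psi> where \<psi>: "Vector_Spaces.linear s1 (*) \<psi>" "\<And>i. \<psi> (g i) = \<phi> (w i)"
        using ext by blast
      interpret p: vector_space_pair s1 "(*) :: 'k \<Rightarrow> 'k \<Rightarrow> 'k"
        using assms(1) vector_space_mult by (rule vector_space_pair.intro)
      have "(\<phi> \<circ> f) (g i) = \<psi> (g i)"
      proof (rule p.linear_eq_on)
        show "Vector_Spaces.linear s1 (*) (\<phi> \<circ> f)" unfolding comp_def by (rule linear_form_comp[OF lin \<phi>])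
        show "Vector_Spaces.linear s1 (*) \<psi>" by fact
        show "g i \<in> vs1.span Bs" using Bs(3) by auto
        fix b assume b: "b \<in> Bs"
        then have "g (inv g b) = b" using Bs(1) by (auto intro: f_inv_into_f)
        then show "(\<phi> \<circ> f) b = \<psi> b"
          using construct_basis[OF Bs(2) b, of "\<lambda>b. w (inv g b)"] \<psi>(2)[of "inv g b"]
          by (simp add: f_def)
      qed
      then show "\<phi> (f (g i) - w i) = 0"
        using \<psi>(2)[of i] module_hom.diff[OF \<phi>[THEN module_hom_iff_linear[THEN iffD2]]] by simp
    qed
    then show ?thesis by simp
  qed
  with lin show ?thesis by blast
qed

lemma linear_evaluation: "Vector_Spaces.linear fun_scale ((*) :: 'k::field \<Rightarrow> 'k \<Rightarrow> 'k) (\<lambda>t. t B)"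
  unfolding Vector_Spaces.linear_iff
  by (simp add: vector_space_fun_scale vector_space_mult, simp add: fun_scale_def)

lemma linear_to_fun:
  assumes "vector_space s" "\<And>B. Vector_Spaces.linear s (*) (\<lambda>x. g x B)"
  shows "Vector_Spaces.linear s fun_scale g"
  unfolding Vector_Spaces.linear_iff
  using assms(1) vector_space_fun_scale assms(2)[unfolded Vector_Spaces.linear_iff]
  by (simp add: fun_scale_def fun_eq_iff)

lemma linear_if_zero:
  assumes "vector_space s" "P \<Longrightarrow> Vector_Spaces.linear s ((*) :: 'k::field \<Rightarrow> 'k \<Rightarrow> 'k) g"
  shows "Vector_Spaces.linear s (*) (\<lambda>x. if P then g x else 0)"
  using assms vector_space_mult by (cases P) (simp_all add: Vector_Spaces.linear_iff)

lemma bilin_tens: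
  assumes "vector_space s1" "vector_space s2"
  shows "bilin s1 s2 fun_scale (tens s1 s2)"
  using assms
  by (auto simp: bilin_def[of _ _ fun_scale] tens_def intro!: linear_to_fun linear_if_zero)
    (auto simp: bilin_def)

theorem tensor_space_universal:
  assumes "vector_space s1" "vector_space s2" and F: "bilin s1 s2 s3 F"
  shows "\<exists>f. Vector_Spaces.linear fun_scale s3 f \<and> (\<forall>u v. f (tens s1 s2 u v) = F u v) \<and>
    (\<forall>f'. Vector_Spaces.linear fun_scale s3 f' \<and> (\<forall>u v. f' (tens s1 s2 u v) = F u v) \<longrightarrow>
       (\<forall>t \<in> tensor_space s1 s2. f' t = f t))"
proof -
  have s3: "vector_space s3" using F unfolding bilin_def Vector_Spaces.linear_iff by blast
  have "\<exists>f. Vector_Spaces.linear fun_scale s3 f \<and> (\<forall>i. f (case_prod (tens s1 s2) i) = case_prod F i)"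
  proof (rule linear_extension[OF vector_space_fun_scale s3])
    fix \<phi> assume \<phi>: "Vector_Spaces.linear s3 (*) \<phi>"
    have "bilin s1 s2 (*) (\<lambda>u v. \<phi> (F u v))"
      using F unfolding bilin_def by (auto intro: linear_form_comp[OF _ \<phi>])
    then show "\<exists>\<psi>. Vector_Spaces.linear fun_scale (*) \<psi> \<and>
        (\<forall>i. \<psi> (case_prod (tens s1 s2) i) = \<phi> (case_prod F i))"
      by (intro exI[of _ "\<lambda>t. t (\<lambda>u v. \<phi> (F u v))"]) (auto simp: linear_evaluation tens_def)
  qed
  then obtain f where f: "Vector_Spaces.linear fun_scale s3 f" "\<And>u v. f (tens s1 s2 u v) = F u v"
    by (simp only: split_paired_All case_prod_conv) blast
  interpret vector_space_pair "fun_scale :: 'a \<Rightarrow> (('b \<Rightarrow> 'c \<Rightarrow> 'a) \<Rightarrow> 'a) \<Rightarrow> _" s3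
    using vector_space_fun_scale s3 by (rule vector_space_pair.intro)
  have "f' t = f t" if "Vector_Spaces.linear fun_scale s3 f'" "\<forall>u v. f' (tens s1 s2 u v) = F u v"
    "t \<in> tensor_space s1 s2" for f' t
    by (rule linear_eq_on[OF that(1) f(1) that(3)[unfolded tensor_space_def]])
      (use that(2) f(2) in auto)
  with f show ?thesis by blast
qed

theorem tens3_universal:
  assumes "trilin s s3 F"
  shows "\<exists>f. Vector_Spaces.linear fun_scale s3 f \<and> (\<forall>u v w. f (tens3 s u v w) = F u v w)"
proof -
  have s3: "vector_space s3" using assms unfolding trilin_def Vector_Spaces.linear_iff by blast
  have "\<exists>f. Vector_Spaces.linear fun_scale s3 f \<and>
      (\<forall>i. f (case i of (u, v, w) \<Rightarrow> tens3 s u v w) = (case i of (u, v, w) \<Rightarrow> F u v w))"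
  proof (rule linear_extension[OF vector_space_fun_scale s3])
    fix \<phi> assume \<phi>: "Vector_Spaces.linear s3 (*) \<phi>"
    have "trilin s (*) (\<lambda>u v w. \<phi> (F u v w))"
      using assms unfolding trilin_def by (auto intro: linear_form_comp[OF _ \<phi>])
    then show "\<exists>\<psi>. Vector_Spaces.linear fun_scale (*) \<psi> \<and>
        (\<forall>i. \<psi> (case i of (u, v, w) \<Rightarrow> tens3 s u v w) = \<phi> (case i of (u, v, w) \<Rightarrow> F u v w))"
      by (intro exI[of _ "\<lambda>t. t (\<lambda>u v w. \<phi> (F u v w))"]) (auto simp: linear_evaluation tens3_def)
  qed
  then show ?thesis by (simp only: split_paired_All case_prod_conv)
qed

lemma trilin_tens3:
  assumes "vector_space s"
  shows "trilin s fun_scale (tens3 s)"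
  using assms
  by (auto simp: trilin_def[of _ fun_scale] tens3_def intro!: linear_to_fun linear_if_zero)
    (auto simp: trilin_def)

lemma sw_tens:
  assumes "bilin s1 s2 fun_scale F"
  shows "sw (tens s1 s2 u v) F = F u v"
proof -
  have "bilin s1 s2 (*) (\<lambda>u v. F u v B)" for B
    using assms unfolding bilin_def by (auto intro: linear_form_comp[OF _ linear_evaluation])
  then show ?thesis by (auto simp: sw_def tens_def)
qed

lemma sw_linear: "Vector_Spaces.linear fun_scale fun_scale (\<lambda>t. sw t F)"
  unfolding Vector_Spaces.linear_iff
  by (simp add: vector_space_fun_scale sw_def fun_scale_def fun_eq_iff)

lemma tau_tens: "tau (tens s1 s2 u v) = tens s2 s1 v u"
proof -
  have eq: "bilin s1 s2 (*) (\<lambda>u v. B v u) \<longleftrightarrow> bilin s2 s1 (*) B" for B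
    by (auto simp: bilin_def)
  show ?thesis unfolding tau_def tens_def by (rule ext) (rule if_cong[OF eq refl refl])
qed

lemma tau13_tens3: "tau13 (tens3 s u v w) = tens3 s w v u"
proof -
  have eq: "trilin s (*) (\<lambda>u v w. B w v u) \<longleftrightarrow> trilin s (*) B" for B
    by (auto simp: trilin_def)
  show ?thesis unfolding tau13_def tens3_def by (rule ext) (rule if_cong[OF eq refl refl])
qed


section \<open>Anti-flexible bialgebras\<close>

definition anti_flexible_algebra :: "('k::field \<Rightarrow> 'a::ab_group_add \<Rightarrow> 'a) \<Rightarrow> ('a \<Rightarrow> 'a \<Rightarrow> 'a) \<Rightarrow> bool" where
  "anti_flexible_algebra s m \<longleftrightarrow> vector_space s \<and> bilin s s s m \<and>
     (\<forall>a b c. m (m a b) c - m a (m b c) = m (m c b) a - m c (m b a))"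

text \<open>The map \<open>(\<Delta> \<otimes> id) \<Delta> - (id \<otimes> \<Delta>) \<Delta>\<close>, with both bracketings of the triple tensor product identified.\<close>

definition coassociator :: "('k::field \<Rightarrow> 'a::ab_group_add \<Rightarrow> 'a) \<Rightarrow> ('a \<Rightarrow> ('k, 'a, 'a) tensor)
    \<Rightarrow> 'a \<Rightarrow> ('k, 'a) tensor3" where
  "coassociator s \<Delta> a =
     sw (\<Delta> a) (\<lambda>a1 a2. sw (\<Delta> a1) (\<lambda>p q. tens3 s p q a2))
   - sw (\<Delta> a) (\<lambda>a1 a2. sw (\<Delta> a2) (\<lambda>p q. tens3 s a1 p q))"

definition anti_flexible_coalgebra :: "('k::field \<Rightarrow> 'a::ab_group_add \<Rightarrow> 'a)
    \<Rightarrow> ('a \<Rightarrow> ('k, 'a, 'a) tensor) \<Rightarrow> bool" where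
  "anti_flexible_coalgebra s \<Delta> \<longleftrightarrow> vector_space s \<and> linear_to_tensor s s s \<Delta> \<and>
     (\<forall>a. coassociator s \<Delta> a = tau13 (coassociator s \<Delta> a))"

definition anti_flexible_bialgebra :: "('k::field \<Rightarrow> 'a::ab_group_add \<Rightarrow> 'a) \<Rightarrow> ('a \<Rightarrow> 'a \<Rightarrow> 'a)
    \<Rightarrow> ('a \<Rightarrow> ('k, 'a, 'a) tensor) \<Rightarrow> bool" where
  "anti_flexible_bialgebra s m \<Delta> \<longleftrightarrow>
     anti_flexible_algebra s m \<and> anti_flexible_coalgebra s \<Delta> \<and>
     (\<forall>a b. \<Delta> (m a b) + tau (\<Delta> (m b a)) =
          sw (\<Delta> a) (\<lambda>a1 a2. tens s s (m a1 b) a2)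
        + sw (\<Delta> a) (\<lambda>a1 a2. tens s s (m b a2) a1)
        + sw (\<Delta> b) (\<lambda>b1 b2. tens s s b1 (m a b2))
        + sw (\<Delta> b) (\<lambda>b1 b2. tens s s b2 (m b1 a))) \<and>
     (\<forall>a b.
        let t = sw (\<Delta> a) (\<lambda>a1 a2. tens s s a1 (m a2 b))
              + sw (\<Delta> b) (\<lambda>b1 b2. tens s s (m a b1) b2)
              - sw (\<Delta> a) (\<lambda>a1 a2. tens s s (m b a1) a2)
              - sw (\<Delta> b) (\<lambda>b1 b2. tens s s b1 (m b2 a))
        in t - tau t = 0)"

definition algebra_hom :: "('k::field \<Rightarrow> 'a::ab_group_add \<Rightarrow> 'a) \<Rightarrow> ('a \<Rightarrow> 'a \<Rightarrow> 'a)
    \<Rightarrow> ('k \<Rightarrow> 'b::ab_group_add \<Rightarrow> 'b) \<Rightarrow> ('b \<Rightarrow> 'b \<Rightarrow> 'b) \<Rightarrow> ('a \<Rightarrow> 'b) \<Rightarrow> bool" where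
  "algebra_hom s m s' m' f \<longleftrightarrow>
     Vector_Spaces.linear s s' f \<and> (\<forall>a b. f (m a b) = m' (f a) (f b))"

definition coalgebra_hom :: "('k::field \<Rightarrow> 'a::ab_group_add \<Rightarrow> 'a) \<Rightarrow> ('a \<Rightarrow> ('k, 'a, 'a) tensor)
    \<Rightarrow> ('k \<Rightarrow> 'b::ab_group_add \<Rightarrow> 'b) \<Rightarrow> ('b \<Rightarrow> ('k, 'b, 'b) tensor) \<Rightarrow> ('a \<Rightarrow> 'b) \<Rightarrow> bool" where
  "coalgebra_hom s \<Delta> s' \<Delta>' f \<longleftrightarrow>
     Vector_Spaces.linear s s' f \<and> (\<forall>a. \<Delta>' (f a) = tmap s' s' f f (\<Delta> a))"


section \<open>Extending data of type (II) and the unified biproduct\<close>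

record ('k, 'a, 'v) extending_maps =
  lharp :: "'v \<Rightarrow> 'a \<Rightarrow> 'a" (infixl "\<rightharpoonup>\<index>" 70)
  rharp :: "'a \<Rightarrow> 'v \<Rightarrow> 'a" (infixl "\<leftharpoonup>\<index>" 70)
  ltri :: "'v \<Rightarrow> 'a \<Rightarrow> 'v" (infixl "\<triangleleft>\<index>" 70)
  rtri :: "'a \<Rightarrow> 'v \<Rightarrow> 'v" (infixl "\<triangleright>\<index>" 70)
  cocyc :: "'v \<Rightarrow> 'v \<Rightarrow> 'a" ("\<sigma>\<index>")
  lcoact :: "'v \<Rightarrow> ('k, 'a, 'v) tensor" ("\<rho>\<index>")
  rcoact :: "'v \<Rightarrow> ('k, 'v, 'a) tensor" ("\<gamma>\<index>")
  cycle :: "'v \<Rightarrow> ('k, 'a, 'a) tensor" ("\<Q>\<index>")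
  multV :: "'v \<Rightarrow> 'v \<Rightarrow> 'v" (infixl "\<cdot>\<^sub>V\<index>" 70)
  comultV :: "'v \<Rightarrow> ('k, 'v, 'v) tensor" ("\<Delta>\<^sub>V\<index>")

definition extending_datum_II :: "('k::field \<Rightarrow> 'a::ab_group_add \<Rightarrow> 'a) \<Rightarrow> ('k \<Rightarrow> 'v::ab_group_add \<Rightarrow> 'v)
    \<Rightarrow> ('k, 'a, 'v) extending_maps \<Rightarrow> bool" where
  "extending_datum_II sA sV D \<longleftrightarrow>
     bilin sV sA sA (lharp D) \<and> bilin sA sV sA (rharp D) \<and>
     bilin sV sA sV (ltri D) \<and> bilin sA sV sV (rtri D) \<and>
     bilin sV sV sA (cocyc D) \<and>
     linear_to_tensor sV sA sV (lcoact D) \<and> linear_to_tensor sV sV sA (rcoact D) \<and>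
     linear_to_tensor sV sA sA (cycle D) \<and>
     bilin sV sV sV (multV D) \<and> linear_to_tensor sV sV sV (comultV D)"

definition sum_scale :: "('k \<Rightarrow> 'a \<Rightarrow> 'a) \<Rightarrow> ('k \<Rightarrow> 'v \<Rightarrow> 'v) \<Rightarrow> 'k \<Rightarrow> 'a \<times> 'v \<Rightarrow> 'a \<times> 'v" where
  "sum_scale sA sV c p = (sA c (fst p), sV c (snd p))"

locale unified_biproduct =
  fixes sA :: "'k::field \<Rightarrow> 'a::ab_group_add \<Rightarrow> 'a"
    and multA :: "'a \<Rightarrow> 'a \<Rightarrow> 'a" (infixl "\<cdot>" 70)
    and comultA :: "'a \<Rightarrow> ('k, 'a, 'a) tensor" ("\<Delta>\<^sub>A")
    and sV :: "'k \<Rightarrow> 'v::ab_group_add \<Rightarrow> 'v"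
    and D :: "('k, 'a, 'v) extending_maps" (structure)
begin

abbreviation tens_AA (infix "\<otimes>\<^sub>A\<^sub>A" 68) where "u \<otimes>\<^sub>A\<^sub>A v \<equiv> tens sA sA u v"
abbreviation tens_AV (infix "\<otimes>\<^sub>A\<^sub>V" 68) where "u \<otimes>\<^sub>A\<^sub>V v \<equiv> tens sA sV u v"
abbreviation tens_VA (infix "\<otimes>\<^sub>V\<^sub>A" 68) where "u \<otimes>\<^sub>V\<^sub>A v \<equiv> tens sV sA u v"
abbreviation tens_VV (infix "\<otimes>\<^sub>V\<^sub>V" 68) where "u \<otimes>\<^sub>V\<^sub>V v \<equiv> tens sV sV u v"

definition multE :: "'a \<times> 'v \<Rightarrow> 'a \<times> 'v \<Rightarrow> 'a \<times> 'v" where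
  "multE = (\<lambda>(a, x) (b, y).
     (a \<cdot> b + x \<rightharpoonup> b + a \<leftharpoonup> y + \<sigma> x y, x \<cdot>\<^sub>V y + x \<triangleleft> b + a \<triangleright> y))"

definition comultE :: "'a \<times> 'v \<Rightarrow> ('k, 'a \<times> 'v, 'a \<times> 'v) tensor" where
  "comultE = (\<lambda>(a, x).
     let s = sum_scale sA sV; iA = (\<lambda>a. (a, 0)); iV = (\<lambda>x. (0, x)) in
       tmap s s iA iA (\<Delta>\<^sub>A a)
     + tmap s s iV iV (\<Delta>\<^sub>V x) + tmap s s iA iV (\<rho> x) + tmap s s iV iA (\<gamma> x) + tmap s s iA iA (\<Q> x))"

text \<open>
  Names of bound variables: \<open>x1, x2\<close> for the legs of a comultiplication, \<open>xm, x0\<close> for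
  \<open>\<rho> x = x\<^sub>[\<^sub>-\<^sub>1\<^sub>] \<otimes> x\<^sub>[\<^sub>0\<^sub>]\<close>, \<open>x0, xp\<close> for \<open>\<gamma> x = x\<^sub>[\<^sub>0\<^sub>] \<otimes> x\<^sub>[\<^sub>1\<^sub>]\<close>, and \<open>xq1, xq2\<close> for \<open>\<Q> x\<close>.
\<close>

definition F1 :: bool where
  "F1 \<longleftrightarrow> (\<forall>x y. \<rho> (x \<cdot>\<^sub>V y) + tau (\<gamma> (y \<cdot>\<^sub>V x)) =
       sw (\<Delta>\<^sub>V x) (\<lambda>x1 x2. \<sigma> y x2 \<otimes>\<^sub>A\<^sub>V x1)
     + sw (\<gamma> x) (\<lambda>x0 xp. (y \<rightharpoonup> xp) \<otimes>\<^sub>A\<^sub>V x0)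
     + sw (\<gamma> y) (\<lambda>y0 yp. yp \<otimes>\<^sub>A\<^sub>V (y0 \<cdot>\<^sub>V x))
     + sw (\<Q> y) (\<lambda>yq1 yq2. yq2 \<otimes>\<^sub>A\<^sub>V (yq1 \<triangleright> x))
     + sw (\<Delta>\<^sub>V x) (\<lambda>x1 x2. \<sigma> x1 y \<otimes>\<^sub>A\<^sub>V x2)
     + sw (\<rho> x) (\<lambda>xm x0. (xm \<leftharpoonup> y) \<otimes>\<^sub>A\<^sub>V x0)
     + sw (\<rho> y) (\<lambda>ym y0. ym \<otimes>\<^sub>A\<^sub>V (x \<cdot>\<^sub>V y0))
     + sw (\<Q> y) (\<lambda>yq1 yq2. yq1 \<otimes>\<^sub>A\<^sub>V (x \<triangleleft> yq2)))"

definition F2 :: bool where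
  "F2 \<longleftrightarrow> (\<forall>b x. \<Delta>\<^sub>A (x \<rightharpoonup> b) + tau (\<Delta>\<^sub>A (b \<leftharpoonup> x)) + \<Q> (x \<triangleleft> b) + tau (\<Q> (b \<triangleright> x)) =
       sw (\<rho> x) (\<lambda>xm x0. (b \<leftharpoonup> x0) \<otimes>\<^sub>A\<^sub>A xm)
     + sw (\<Q> x) (\<lambda>xq1 xq2. (b \<cdot> xq2) \<otimes>\<^sub>A\<^sub>A xq1)
     + sw (\<Delta>\<^sub>A b) (\<lambda>b1 b2. b2 \<otimes>\<^sub>A\<^sub>A (b1 \<leftharpoonup> x))
     + sw (\<gamma> x) (\<lambda>x0 xp. (x0 \<rightharpoonup> b) \<otimes>\<^sub>A\<^sub>A xp)
     + sw (\<Q> x) (\<lambda>xq1 xq2. (xq1 \<cdot> b) \<otimes>\<^sub>A\<^sub>A xq2)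
     + sw (\<Delta>\<^sub>A b) (\<lambda>b1 b2. b1 \<otimes>\<^sub>A\<^sub>A (x \<rightharpoonup> b2)))"

definition F3 :: bool where
  "F3 \<longleftrightarrow> (\<forall>a y. \<Delta>\<^sub>V (a \<triangleright> y) + tau (\<Delta>\<^sub>V (y \<triangleleft> a)) =
       sw (\<Delta>\<^sub>V y) (\<lambda>y1 y2. y2 \<otimes>\<^sub>V\<^sub>V (y1 \<triangleleft> a))
     + sw (\<Delta>\<^sub>V y) (\<lambda>y1 y2. y1 \<otimes>\<^sub>V\<^sub>V (a \<triangleright> y2)))"

definition F4 :: bool where
  "F4 \<longleftrightarrow> (\<forall>x y. \<Delta>\<^sub>A (\<sigma> x y) + tau (\<Delta>\<^sub>A (\<sigma> y x)) + \<Q> (x \<cdot>\<^sub>V y) + tau (\<Q> (y \<cdot>\<^sub>V x)) =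
       sw (\<Q> x) (\<lambda>xq1 xq2. (y \<rightharpoonup> xq2) \<otimes>\<^sub>A\<^sub>A xq1)
     + sw (\<rho> x) (\<lambda>xm x0. \<sigma> y x0 \<otimes>\<^sub>A\<^sub>A xm)
     + sw (\<gamma> y) (\<lambda>y0 yp. yp \<otimes>\<^sub>A\<^sub>A \<sigma> y0 x)
     + sw (\<Q> y) (\<lambda>yq1 yq2. yq2 \<otimes>\<^sub>A\<^sub>A (yq1 \<leftharpoonup> x))
     + sw (\<gamma> x) (\<lambda>x0 xp. \<sigma> x0 y \<otimes>\<^sub>A\<^sub>A xp)
     + sw (\<Q> x) (\<lambda>xq1 xq2. (xq1 \<leftharpoonup> y) \<otimes>\<^sub>A\<^sub>A xq2)
     + sw (\<rho> y) (\<lambda>ym y0. ym \<otimes>\<^sub>A\<^sub>A \<sigma> x y0)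
     + sw (\<Q> y) (\<lambda>yq1 yq2. yq1 \<otimes>\<^sub>A\<^sub>A (x \<rightharpoonup> yq2)))"

definition F5 :: bool where
  "F5 \<longleftrightarrow> (\<forall>b x. \<gamma> (x \<triangleleft> b) + tau (\<rho> (b \<triangleright> x)) =
       sw (\<rho> x) (\<lambda>xm x0. (b \<triangleright> x0) \<otimes>\<^sub>V\<^sub>A xm)
     + sw (\<gamma> x) (\<lambda>x0 xp. (x0 \<triangleleft> b) \<otimes>\<^sub>V\<^sub>A xp))"

definition F6 :: bool where
  "F6 \<longleftrightarrow> (\<forall>b x. \<rho> (x \<triangleleft> b) + tau (\<gamma> (b \<triangleright> x)) =
       sw (\<Delta>\<^sub>V x) (\<lambda>x1 x2. (b \<leftharpoonup> x2) \<otimes>\<^sub>A\<^sub>V x1)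
     + sw (\<gamma> x) (\<lambda>x0 xp. (b \<cdot> xp) \<otimes>\<^sub>A\<^sub>V x0)
     + sw (\<Delta>\<^sub>A b) (\<lambda>b1 b2. b2 \<otimes>\<^sub>A\<^sub>V (b1 \<triangleright> x))
     + sw (\<Delta>\<^sub>V x) (\<lambda>x1 x2. (x1 \<rightharpoonup> b) \<otimes>\<^sub>A\<^sub>V x2)
     + sw (\<rho> x) (\<lambda>xm x0. (xm \<cdot> b) \<otimes>\<^sub>A\<^sub>V x0)
     + sw (\<Delta>\<^sub>A b) (\<lambda>b1 b2. b1 \<otimes>\<^sub>A\<^sub>V (x \<triangleleft> b2)))"

definition F7 :: bool where
  "F7 \<longleftrightarrow> (\<forall>b x.
       sw (\<Delta>\<^sub>V x) (\<lambda>x1 x2. x1 \<otimes>\<^sub>V\<^sub>A (x2 \<rightharpoonup> b))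
     + sw (\<gamma> x) (\<lambda>x0 xp. x0 \<otimes>\<^sub>V\<^sub>A (xp \<cdot> b))
     + sw (\<Delta>\<^sub>A b) (\<lambda>b1 b2. (x \<triangleleft> b1) \<otimes>\<^sub>V\<^sub>A b2)
     - sw (\<gamma> x) (\<lambda>x0 xp. (b \<triangleright> x0) \<otimes>\<^sub>V\<^sub>A xp)
     = tau (sw (\<rho> x) (\<lambda>xm x0. xm \<otimes>\<^sub>A\<^sub>V (x0 \<triangleleft> b))
          - sw (\<Delta>\<^sub>A b) (\<lambda>b1 b2. b1 \<otimes>\<^sub>A\<^sub>V (b2 \<triangleright> x))
          - sw (\<Delta>\<^sub>V x) (\<lambda>x1 x2. (b \<leftharpoonup> x1) \<otimes>\<^sub>A\<^sub>V x2)
          - sw (\<rho> x) (\<lambda>xm x0. (b \<cdot> xm) \<otimes>\<^sub>A\<^sub>V x0)))"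

definition F8 :: bool where
  "F8 \<longleftrightarrow> (\<forall>b x.
       let t = sw (\<Delta>\<^sub>V x) (\<lambda>x1 x2. x1 \<otimes>\<^sub>V\<^sub>V (x2 \<triangleleft> b))
             - sw (\<Delta>\<^sub>V x) (\<lambda>x1 x2. (b \<triangleright> x1) \<otimes>\<^sub>V\<^sub>V x2)
       in t - tau t = 0)"

definition F9 :: bool where
  "F9 \<longleftrightarrow> (\<forall>x y.
       sw (\<Delta>\<^sub>V x) (\<lambda>x1 x2. x1 \<otimes>\<^sub>V\<^sub>A \<sigma> x2 y)
     + sw (\<gamma> x) (\<lambda>x0 xp. x0 \<otimes>\<^sub>V\<^sub>A (xp \<leftharpoonup> y))
     + sw (\<gamma> y) (\<lambda>y0 yp. (x \<cdot>\<^sub>V y0) \<otimes>\<^sub>V\<^sub>A yp)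
     + sw (\<Q> y) (\<lambda>yq1 yq2. (x \<triangleleft> yq1) \<otimes>\<^sub>V\<^sub>A yq2)
     - sw (\<Delta>\<^sub>V y) (\<lambda>y1 y2. y1 \<otimes>\<^sub>V\<^sub>A \<sigma> y2 x)
     - sw (\<gamma> y) (\<lambda>y0 yp. y0 \<otimes>\<^sub>V\<^sub>A (yp \<leftharpoonup> x))
     - sw (\<gamma> x) (\<lambda>x0 xp. (y \<cdot>\<^sub>V x0) \<otimes>\<^sub>V\<^sub>A xp)
     - sw (\<Q> x) (\<lambda>xq1 xq2. (y \<triangleleft> xq1) \<otimes>\<^sub>V\<^sub>A xq2)
     = tau (sw (\<rho> x) (\<lambda>xm x0. xm \<otimes>\<^sub>A\<^sub>V (x0 \<cdot>\<^sub>V y))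
          + sw (\<Q> x) (\<lambda>xq1 xq2. xq1 \<otimes>\<^sub>A\<^sub>V (xq2 \<triangleright> y))
          + sw (\<Delta>\<^sub>V y) (\<lambda>y1 y2. \<sigma> x y1 \<otimes>\<^sub>A\<^sub>V y2)
          + sw (\<rho> y) (\<lambda>ym y0. (x \<rightharpoonup> ym) \<otimes>\<^sub>A\<^sub>V y0)
          - sw (\<rho> y) (\<lambda>ym y0. ym \<otimes>\<^sub>A\<^sub>V (y0 \<cdot>\<^sub>V x))
          - sw (\<Q> y) (\<lambda>yq1 yq2. yq1 \<otimes>\<^sub>A\<^sub>V (yq2 \<triangleright> x))
          - sw (\<Delta>\<^sub>V x) (\<lambda>x1 x2. \<sigma> y x1 \<otimes>\<^sub>A\<^sub>V x2)
          - sw (\<rho> x) (\<lambda>xm x0. (y \<rightharpoonup> xm) \<otimes>\<^sub>A\<^sub>V x0)))"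

definition F10 :: bool where
  "F10 \<longleftrightarrow> (\<forall>b x.
       let t = sw (\<rho> x) (\<lambda>xm x0. xm \<otimes>\<^sub>A\<^sub>A (x0 \<rightharpoonup> b))
             + sw (\<Q> x) (\<lambda>xq1 xq2. xq1 \<otimes>\<^sub>A\<^sub>A (xq2 \<cdot> b))
             + sw (\<Delta>\<^sub>A b) (\<lambda>b1 b2. (x \<rightharpoonup> b1) \<otimes>\<^sub>A\<^sub>A b2);
           t' = sw (\<Delta>\<^sub>A b) (\<lambda>b1 b2. b1 \<otimes>\<^sub>A\<^sub>A (b2 \<leftharpoonup> x))
             + sw (\<gamma> x) (\<lambda>x0 xp. (b \<leftharpoonup> x0) \<otimes>\<^sub>A\<^sub>A xp)
             + sw (\<Q> x) (\<lambda>xq1 xq2. (b \<cdot> xq1) \<otimes>\<^sub>A\<^sub>A xq2)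
       in t - tau t = t' - tau t')"

definition F11 :: bool where
  "F11 \<longleftrightarrow> (\<forall>x y.
       let t = sw (\<rho> x) (\<lambda>xm x0. xm \<otimes>\<^sub>A\<^sub>A \<sigma> x0 y)
             + sw (\<Q> x) (\<lambda>xq1 xq2. xq1 \<otimes>\<^sub>A\<^sub>A (xq2 \<leftharpoonup> y))
             + sw (\<gamma> y) (\<lambda>y0 yp. \<sigma> x y0 \<otimes>\<^sub>A\<^sub>A yp)
             + sw (\<Q> y) (\<lambda>yq1 yq2. (x \<rightharpoonup> yq1) \<otimes>\<^sub>A\<^sub>A yq2);
           t' = sw (\<rho> y) (\<lambda>ym y0. ym \<otimes>\<^sub>A\<^sub>A \<sigma> y0 x)
             + sw (\<Q> y) (\<lambda>yq1 yq2. yq1 \<otimes>\<^sub>A\<^sub>A (yq2 \<leftharpoonup> x))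
             + sw (\<gamma> x) (\<lambda>x0 xp. \<sigma> y x0 \<otimes>\<^sub>A\<^sub>A xp)
             + sw (\<Q> x) (\<lambda>xq1 xq2. (y \<rightharpoonup> xq1) \<otimes>\<^sub>A\<^sub>A xq2)
       in t - tau t = t' - tau t')"

definition F12 :: bool where
  "F12 \<longleftrightarrow> (\<forall>x y. \<Delta>\<^sub>V (x \<cdot>\<^sub>V y) + tau (\<Delta>\<^sub>V (y \<cdot>\<^sub>V x)) =
       sw (\<Delta>\<^sub>V x) (\<lambda>x1 x2. (y \<cdot>\<^sub>V x2) \<otimes>\<^sub>V\<^sub>V x1)
     + sw (\<Delta>\<^sub>V y) (\<lambda>y1 y2. y2 \<otimes>\<^sub>V\<^sub>V (y1 \<cdot>\<^sub>V x))
     + sw (\<Delta>\<^sub>V x) (\<lambda>x1 x2. (x1 \<cdot>\<^sub>V y) \<otimes>\<^sub>V\<^sub>V x2)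
     + sw (\<Delta>\<^sub>V y) (\<lambda>y1 y2. y1 \<otimes>\<^sub>V\<^sub>V (x \<cdot>\<^sub>V y2))
     + sw (\<gamma> x) (\<lambda>x0 xp. (y \<triangleleft> xp) \<otimes>\<^sub>V\<^sub>V x0)
     + sw (\<rho> y) (\<lambda>ym y0. y0 \<otimes>\<^sub>V\<^sub>V (ym \<triangleright> x))
     + sw (\<rho> x) (\<lambda>xm x0. (xm \<triangleright> y) \<otimes>\<^sub>V\<^sub>V x0)
     + sw (\<gamma> y) (\<lambda>y0 yp. y0 \<otimes>\<^sub>V\<^sub>V (x \<triangleleft> yp)))"

definition F13 :: bool where
  "F13 \<longleftrightarrow> (\<forall>x y.
       let t = sw (\<Delta>\<^sub>V x) (\<lambda>x1 x2. x1 \<otimes>\<^sub>V\<^sub>V (x2 \<cdot>\<^sub>V y))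
             + sw (\<Delta>\<^sub>V y) (\<lambda>y1 y2. (x \<cdot>\<^sub>V y1) \<otimes>\<^sub>V\<^sub>V y2)
             - sw (\<Delta>\<^sub>V y) (\<lambda>y1 y2. y1 \<otimes>\<^sub>V\<^sub>V (y2 \<cdot>\<^sub>V x))
             - sw (\<Delta>\<^sub>V x) (\<lambda>x1 x2. (y \<cdot>\<^sub>V x1) \<otimes>\<^sub>V\<^sub>V x2);
           t' = sw (\<gamma> x) (\<lambda>x0 xp. x0 \<otimes>\<^sub>V\<^sub>V (xp \<triangleright> y))
             + sw (\<rho> y) (\<lambda>ym y0. (x \<triangleleft> ym) \<otimes>\<^sub>V\<^sub>V y0)
             - sw (\<gamma> y) (\<lambda>y0 yp. y0 \<otimes>\<^sub>V\<^sub>V (yp \<triangleright> x))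
             - sw (\<rho> x) (\<lambda>xm x0. (y \<triangleleft> xm) \<otimes>\<^sub>V\<^sub>V x0)
       in (t - tau t) + (t' - tau t') = 0)"

definition compatible :: bool where
  "compatible \<longleftrightarrow> F1 \<and> F2 \<and> F3 \<and> F4 \<and> F5 \<and> F6 \<and> F7 \<and> F8 \<and> F9 \<and> F10 \<and> F11 \<and> F12 \<and> F13"

end

end

(*
  Write L, R for left and right multiplication, Ci for compat1, compat2 and Di for defect1, defect2:
    C1(a, b) = \<Delta>(ab) - (R_b \<otimes> id) \<Delta>(a) - (id \<otimes> L_a) \<Delta>(b),
    C2(a, b) = (id \<otimes> R_b) \<Delta>(a) + (L_a \<otimes> id) \<Delta>(b).
  The bialgebra conditions say that D1(a, b) = C1(a, b) + \<tau> C1(b, a) and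
  D2(a, b) = (id - \<tau>) (C2(a, b) - C2(b, a)) vanish. Both are biadditive, natural under
  homomorphisms, and satisfy D1(b, a) = \<tau> D1(a, b) and D2(b, a) = - D2(a, b). On A \<oplus> V they
  vanish on A x A by naturality, so only the values on V x A and V x V matter, and (F1)-(F13) are the
  components of these values under (A \<oplus> V) \<otimes> (A \<oplus> V) = AA + AV + VA + VV; the symmetries of D1
  and D2 make the remaining components redundant. For the converse, the structure of E is transported
  along (a, x) \<mapsto> i a + j x, and the extending datum consists of the components of the result.
*)
theory Submission
  imports Defs
begin

section \<open>Calculus of maps between tensor products\<close>

lemma linear_ident: "vector_space s \<Longrightarrow> Vector_Spaces.linear s s (\<lambda>x. x)"
  unfolding Vector_Spaces.linear_iff by simp

lemma linear_zero_map:
  assumes "vector_space s1" "vector_space s2"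
  shows "Vector_Spaces.linear s1 s2 (\<lambda>x. 0)"
proof -
  interpret vector_space_pair s1 s2 using assms by (rule vector_space_pair.intro)
  show ?thesis by (rule linear_zero)
qed

lemma linear_add_map:
  assumes "Vector_Spaces.linear s1 s2 f" "Vector_Spaces.linear s1 s2 g"
  shows "Vector_Spaces.linear s1 s2 (\<lambda>x. f x + g x)"
proof -
  interpret vector_space_pair s1 s2
    using assms(1) by (auto simp: Vector_Spaces.linear_iff intro: vector_space_pair.intro)
  show ?thesis by (rule linear_compose_add[OF assms])
qed

lemma linear_zero: "Vector_Spaces.linear s1 s2 f \<Longrightarrow> f 0 = 0"
  using module_hom.zero module_hom_iff_linear by blast

lemma linear_add: "Vector_Spaces.linear s1 s2 f \<Longrightarrow> f (x + y) = f x + f y"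
  using module_hom.add module_hom_iff_linear by blast

lemma linear_vector_spaces:
  "Vector_Spaces.linear s1 s2 f \<Longrightarrow> vector_space s1 \<and> vector_space s2"
  unfolding Vector_Spaces.linear_iff by blast

lemma bilin_linear:
  assumes "bilin s1 s2 s3 F"
  shows "Vector_Spaces.linear s1 s3 (\<lambda>x. F x y)" "Vector_Spaces.linear s2 s3 (F x)"
  using assms by (auto simp: bilin_def)

lemma bilin_comp:
  assumes "bilin s1 s2 s3 F" "Vector_Spaces.linear r1 s1 f" "Vector_Spaces.linear r2 s2 g"
  shows "bilin r1 r2 s3 (\<lambda>u v. F (f u) (g v))"
  using linear_form_comp[OF assms(2) bilin_linear(1)[OF assms(1)]]
    linear_form_comp[OF assms(3) bilin_linear(2)[OF assms(1)]]
  by (simp add: bilin_def)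

lemma bilin_tens_comp:
  assumes "Vector_Spaces.linear r1 s1 f" "Vector_Spaces.linear r2 s2 g"
  shows "bilin r1 r2 fun_scale (\<lambda>u v. tens s1 s2 (f u) (g v))"
  using bilin_comp[OF bilin_tens assms] linear_vector_spaces[OF assms(1)] linear_vector_spaces[OF assms(2)]
  by simp

lemma tensor_ext:
  assumes "t \<in> tensor_space s1 s2"
    and f: "Vector_Spaces.linear fun_scale s3 f" and g: "Vector_Spaces.linear fun_scale s3 g"
    and "\<And>u v. f (tens s1 s2 u v) = g (tens s1 s2 u v)"
  shows "f t = g t"
  by (rule vector_space_pair.linear_eq_on[OF _ f g assms(1)[unfolded tensor_space_def]])
    (use assms(4) linear_vector_spaces[OF f] in \<open>auto intro: vector_space_pair.intro\<close>)

lemma module_fun_scale: "module (fun_scale :: 'k::field \<Rightarrow> ('b \<Rightarrow> 'k) \<Rightarrow> 'b \<Rightarrow> 'k)"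
  using vector_space_fun_scale module_iff_vector_space by blast

lemma tens_mem: "tens s1 s2 u v \<in> tensor_space s1 s2"
  unfolding tensor_space_def by (rule module.span_base[OF module_fun_scale]) blast

lemma tensor_space_add: "t \<in> tensor_space s1 s2 \<Longrightarrow> t' \<in> tensor_space s1 s2 \<Longrightarrow> t + t' \<in> tensor_space s1 s2"
  unfolding tensor_space_def by (rule module.span_add[OF module_fun_scale])

lemma tensor_space_diff: "t \<in> tensor_space s1 s2 \<Longrightarrow> t' \<in> tensor_space s1 s2 \<Longrightarrow> t - t' \<in> tensor_space s1 s2"
  unfolding tensor_space_def by (rule module.span_diff[OF module_fun_scale])

lemma tensor_space_image:
  assumes f: "Vector_Spaces.linear fun_scale fun_scale f"
    and "\<And>u v. f (tens s1 s2 u v) \<in> tensor_space r1 r2"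
    and "t \<in> tensor_space s1 s2"
  shows "f t \<in> tensor_space r1 r2"
proof -
  have hom: "module_hom fun_scale fun_scale f" using f module_hom_iff_linear by blast
  have "f ` tensor_space s1 s2 = module.span fun_scale (f ` {tens s1 s2 u v | u v. True})"
    unfolding tensor_space_def by (rule module_hom.span_image[OF hom, symmetric])
  also have "\<dots> \<subseteq> tensor_space r1 r2"
    by (rule module.span_minimal[OF module_fun_scale])
      (use assms(2) in \<open>auto simp: tensor_space_def module.subspace_span[OF module_fun_scale]\<close>)
  finally show ?thesis using assms(3) by auto
qed

lemma tau_add: "tau (t + t') = tau t + tau t'"
  and tau_diff: "tau (t - t') = tau t - tau t'"
  and tau_zero: "tau 0 = 0"
  by (simp_all add: tau_def fun_eq_iff)

lemma tau_tau: "tau (tau t) = t"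
  by (simp add: tau_def)

lemma tau_linear: "Vector_Spaces.linear fun_scale fun_scale tau"
  unfolding Vector_Spaces.linear_iff
  by (simp add: vector_space_fun_scale tau_add) (simp add: tau_def fun_scale_def)

lemma tau_eq_0_iff: "tau t = 0 \<longleftrightarrow> t = 0"
  using tau_tau[of t] by (auto simp: tau_zero)

lemma tau_mem: "t \<in> tensor_space s1 s2 \<Longrightarrow> tau t \<in> tensor_space s2 s1"
  by (rule tensor_space_image[OF tau_linear]) (auto simp: tau_tens tens_mem)

lemma tmap_linear: "Vector_Spaces.linear fun_scale fun_scale (tmap s1 s2 f g)"
  unfolding tmap_def[abs_def] by (rule sw_linear)

lemma tmap_add: "tmap s1 s2 f g (t + t') = tmap s1 s2 f g t + tmap s1 s2 f g t'"
  and tmap_diff: "tmap s1 s2 f g (t - t') = tmap s1 s2 f g t - tmap s1 s2 f g t'"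
  and tmap_zero: "tmap s1 s2 f g 0 = 0"
  by (simp_all add: tmap_def sw_def fun_eq_iff)

lemma tmap_tens:
  assumes "Vector_Spaces.linear r1 s1 f" "Vector_Spaces.linear r2 s2 g"
  shows "tmap s1 s2 f g (tens r1 r2 u v) = tens s1 s2 (f u) (g v)"
  unfolding tmap_def by (rule sw_tens[OF bilin_tens_comp[OF assms]])

lemma tmap_mem:
  assumes "Vector_Spaces.linear r1 s1 f" "Vector_Spaces.linear r2 s2 g" "t \<in> tensor_space r1 r2"
  shows "tmap s1 s2 f g t \<in> tensor_space s1 s2"
  by (rule tensor_space_image[OF tmap_linear _ assms(3)]) (simp add: tmap_tens[OF assms(1,2)] tens_mem)

lemma sw_tmap:
  assumes "bilin s1 s2 fun_scale F"
  shows "sw (tmap s1 s2 f g t) F = sw t (\<lambda>u v. F (f u) (g v))"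
proof -
  have "bilin s1 s2 (*) (\<lambda>u v. F u v B)" for B
    using assms unfolding bilin_def by (auto intro: linear_form_comp[OF _ linear_evaluation])
  then show ?thesis by (simp add: sw_def tmap_def tens_def)
qed

lemma tmap_tmap:
  assumes "Vector_Spaces.linear r1 s1 f" "Vector_Spaces.linear r2 s2 g"
  shows "tmap s1 s2 f g (tmap r1 r2 h k t) = tmap s1 s2 (\<lambda>u. f (h u)) (\<lambda>v. g (k v)) t"
  unfolding tmap_def[of s1] by (rule sw_tmap[OF bilin_tens_comp[OF assms]])

lemma tau_tmap: "tau (tmap s1 s2 f g t) = sw t (\<lambda>u v. tens s2 s1 (g v) (f u))"
proof -
  have "tens s1 s2 (f u) (g v) (\<lambda>u v. B v u) = tens s2 s1 (g v) (f u) B" for u v B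
    using fun_cong[OF tau_tens[of s1 s2 "f u" "g v"]] by (simp add: tau_def)
  then show ?thesis by (simp add: tau_def tmap_def sw_def)
qed

lemma tmap_tau: "tmap s1 s2 f g (tau t) = tau (tmap s2 s1 g f t)"
  unfolding tau_tmap by (simp add: tau_def tmap_def sw_def)

lemma tmap_ident:
  assumes "vector_space s1" "vector_space s2" "t \<in> tensor_space s1 s2"
  shows "tmap s1 s2 (\<lambda>u. u) (\<lambda>v. v) t = t"
  by (rule tensor_ext[OF assms(3) tmap_linear linear_ident])
    (simp_all add: vector_space_fun_scale tmap_tens linear_ident assms)

lemma tens_add_left: "vector_space s1 \<Longrightarrow> vector_space s2 \<Longrightarrow> tens s1 s2 (u + u') v = tens s1 s2 u v + tens s1 s2 u' v"
  and tens_add_right: "vector_space s1 \<Longrightarrow> vector_space s2 \<Longrightarrow> tens s1 s2 u (v + v') = tens s1 s2 u v + tens s1 s2 u v'"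
  and tens_zero_left: "vector_space s1 \<Longrightarrow> vector_space s2 \<Longrightarrow> tens s1 s2 0 v = 0"
  and tens_zero_right: "vector_space s1 \<Longrightarrow> vector_space s2 \<Longrightarrow> tens s1 s2 u 0 = 0"
  using linear_add[OF bilin_linear(1)[OF bilin_tens]] linear_add[OF bilin_linear(2)[OF bilin_tens]]
    linear_zero[OF bilin_linear(1)[OF bilin_tens]] linear_zero[OF bilin_linear(2)[OF bilin_tens]]
  by blast+

lemma tmap_add_left:
  assumes "Vector_Spaces.linear r1 s1 f" "Vector_Spaces.linear r1 s1 f'" "Vector_Spaces.linear r2 s2 g"
    and "t \<in> tensor_space r1 r2"
  shows "tmap s1 s2 (\<lambda>u. f u + f' u) g t = tmap s1 s2 f g t + tmap s1 s2 f' g t"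
  by (rule tensor_ext[OF assms(4) tmap_linear linear_add_map[OF tmap_linear tmap_linear]])
    (use linear_vector_spaces[OF assms(1)] linear_vector_spaces[OF assms(3)] in
      \<open>simp add: tmap_tens assms(1-3) linear_add_map tens_add_left\<close>)

lemma tmap_add_right:
  assumes "Vector_Spaces.linear r1 s1 f" "Vector_Spaces.linear r2 s2 g" "Vector_Spaces.linear r2 s2 g'"
    and "t \<in> tensor_space r1 r2"
  shows "tmap s1 s2 f (\<lambda>v. g v + g' v) t = tmap s1 s2 f g t + tmap s1 s2 f g' t"
  by (rule tensor_ext[OF assms(4) tmap_linear linear_add_map[OF tmap_linear tmap_linear]])
    (use linear_vector_spaces[OF assms(1)] linear_vector_spaces[OF assms(3)] in
      \<open>simp add: tmap_tens assms(1-3) linear_add_map tens_add_right\<close>)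

lemma sw_zero_map: "t \<in> tensor_space s1 s2 \<Longrightarrow> sw t (\<lambda>u v. 0) = 0"
  by (erule tensor_ext[OF _ sw_linear linear_zero_map])
    (auto simp: vector_space_fun_scale sw_def tens_def fun_eq_iff)

lemma tmap_zero_left:
  assumes "vector_space s1" "vector_space s2" "t \<in> tensor_space r1 r2"
  shows "tmap s1 s2 (\<lambda>u. 0) g t = 0"
  by (simp add: tmap_def tens_zero_left assms(1,2) sw_zero_map[OF assms(3)])

lemma tmap_zero_right:
  assumes "vector_space s1" "vector_space s2" "t \<in> tensor_space r1 r2"
  shows "tmap s1 s2 f (\<lambda>v. 0) t = 0"
  by (simp add: tmap_def tens_zero_right assms(1,2) sw_zero_map[OF assms(3)])

section \<open>The two compatibility conditions of a bialgebra\<close>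

definition compat1 :: "('k::field \<Rightarrow> 'a::ab_group_add \<Rightarrow> 'a) \<Rightarrow> ('a \<Rightarrow> 'a \<Rightarrow> 'a)
    \<Rightarrow> ('a \<Rightarrow> ('k, 'a, 'a) tensor) \<Rightarrow> 'a \<Rightarrow> 'a \<Rightarrow> ('k, 'a, 'a) tensor" where
  "compat1 s m \<Delta> a b =
     \<Delta> (m a b) - tmap s s (\<lambda>u. m u b) (\<lambda>v. v) (\<Delta> a) - tmap s s (\<lambda>u. u) (m a) (\<Delta> b)"

definition compat2 :: "('k::field \<Rightarrow> 'a::ab_group_add \<Rightarrow> 'a) \<Rightarrow> ('a \<Rightarrow> 'a \<Rightarrow> 'a)
    \<Rightarrow> ('a \<Rightarrow> ('k, 'a, 'a) tensor) \<Rightarrow> 'a \<Rightarrow> 'a \<Rightarrow> ('k, 'a, 'a) tensor" where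
  "compat2 s m \<Delta> a b =
     tmap s s (\<lambda>u. u) (\<lambda>v. m v b) (\<Delta> a) + tmap s s (m a) (\<lambda>v. v) (\<Delta> b)"

definition defect1 where
  "defect1 s m \<Delta> a b = compat1 s m \<Delta> a b + tau (compat1 s m \<Delta> b a)"

definition defect2 where
  "defect2 s m \<Delta> a b = (compat2 s m \<Delta> a b - compat2 s m \<Delta> b a) - tau (compat2 s m \<Delta> a b - compat2 s m \<Delta> b a)"

lemma sw_tens_eq_tmap:
  "sw t (\<lambda>u v. tens s1 s2 (f u) (g v)) = tmap s1 s2 f g t"
  "sw t (\<lambda>u v. tens s2 s1 (g v) (f u)) = tau (tmap s1 s2 f g t)"
  by (simp add: tmap_def) (simp add: tau_tmap)

lemma eq_iff_diff: "P = Q \<longleftrightarrow> R = 0" if "P - Q = R" for P Q R :: "'t::ab_group_add"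
  using that by auto

lemma anti_flexible_bialgebra_iff:
  "anti_flexible_bialgebra s m \<Delta> \<longleftrightarrow>
     anti_flexible_algebra s m \<and> anti_flexible_coalgebra s \<Delta> \<and>
     (\<forall>a b. defect1 s m \<Delta> a b = 0) \<and> (\<forall>a b. defect2 s m \<Delta> a b = 0)"
  unfolding anti_flexible_bialgebra_def sw_tens_eq_tmap Let_def
  by (intro conj_cong refl arg_cong[where f=All] ext)
    (rule eq_iff_diff, simp add: defect1_def compat1_def tau_add tau_diff,
     simp add: defect2_def compat2_def tau_add tau_diff algebra_simps)

lemma defect1_swap: "defect1 s m \<Delta> b a = tau (defect1 s m \<Delta> a b)"
  by (simp add: defect1_def tau_add tau_tau add.commute)

lemma defect2_swap: "defect2 s m \<Delta> b a = - defect2 s m \<Delta> a b"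
  by (simp add: defect2_def tau_diff)

lemma compat_hom:
  assumes "bilin s s s m" "bilin s' s' s' m'"
    and f: "algebra_hom s m s' m' f" "coalgebra_hom s \<Delta> s' \<Delta>' f"
  shows "compat1 s' m' \<Delta>' (f a) (f b) = tmap s' s' f f (compat1 s m \<Delta> a b)"
    and "compat2 s' m' \<Delta>' (f a) (f b) = tmap s' s' f f (compat2 s m \<Delta> a b)"
proof -
  have lin: "Vector_Spaces.linear s s' f" and hom: "\<And>a b. m' (f a) (f b) = f (m a b)"
    and cohom: "\<And>a. \<Delta>' (f a) = tmap s' s' f f (\<Delta> a)"
    using f by (auto simp: algebra_hom_def coalgebra_hom_def)
  have vs: "vector_space s" "vector_space s'" using linear_vector_spaces[OF lin] by auto
  note bl = bilin_linear[OF assms(1)] bilin_linear[OF assms(2)]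
  show "compat1 s' m' \<Delta>' (f a) (f b) = tmap s' s' f f (compat1 s m \<Delta> a b)"
    "compat2 s' m' \<Delta>' (f a) (f b) = tmap s' s' f f (compat2 s m \<Delta> a b)"
    by (simp_all add: compat1_def compat2_def hom cohom tmap_add tmap_diff tmap_tmap lin bl vs linear_ident)
qed

lemma defect_hom:
  assumes "bilin s s s m" "bilin s' s' s' m'"
    and "algebra_hom s m s' m' f" "coalgebra_hom s \<Delta> s' \<Delta>' f"
  shows "defect1 s' m' \<Delta>' (f a) (f b) = tmap s' s' f f (defect1 s m \<Delta> a b)"
    and "defect2 s' m' \<Delta>' (f a) (f b) = tmap s' s' f f (defect2 s m \<Delta> a b)"
  by (simp_all add: defect1_def defect2_def compat_hom[OF assms] tmap_add tmap_diff tmap_tau)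

lemma compat_mem:
  assumes "bilin s s s m" "linear_to_tensor s s s \<Delta>"
  shows "compat1 s m \<Delta> a b \<in> tensor_space s s" "compat2 s m \<Delta> a b \<in> tensor_space s s"
proof -
  note l = bilin_linear[OF assms(1)]
  have "vector_space s" using linear_vector_spaces[OF l(1)] by auto
  then show "compat1 s m \<Delta> a b \<in> tensor_space s s" "compat2 s m \<Delta> a b \<in> tensor_space s s"
    using assms(2) unfolding linear_to_tensor_def compat1_def compat2_def
    by (auto intro!: tensor_space_add tensor_space_diff tmap_mem[where ?r1.0=s and ?r2.0=s] linear_ident l)
qed

lemma compat_biadditive:
  assumes "bilin s s s m" "linear_to_tensor s s s \<Delta>"
  shows "compat1 s m \<Delta> (a + a') b = compat1 s m \<Delta> a b + compat1 s m \<Delta> a' b"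
    and "compat1 s m \<Delta> a (b + b') = compat1 s m \<Delta> a b + compat1 s m \<Delta> a b'"
    and "compat2 s m \<Delta> (a + a') b = compat2 s m \<Delta> a b + compat2 s m \<Delta> a' b"
    and "compat2 s m \<Delta> a (b + b') = compat2 s m \<Delta> a b + compat2 s m \<Delta> a b'"
proof -
  note l = bilin_linear[OF assms(1)]
  have vs: "vector_space s" using linear_vector_spaces[OF l(1)] by auto
  have \<Delta>: "\<And>a b. \<Delta> (a + b) = \<Delta> a + \<Delta> b" "\<And>a. \<Delta> a \<in> tensor_space s s"
    using assms(2) by (auto simp: linear_to_tensor_def linear_add)
  have m: "m (a + a') = (\<lambda>b. m a b + m a' b)" "m a (b + b') = m a b + m a b'" for a a' b b'
    using linear_add[OF l(1)] linear_add[OF l(2)] by auto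
  note L = tmap_add_left[where ?r1.0=s and ?r2.0=s] tmap_add_right[where ?r1.0=s and ?r2.0=s]
  show "compat1 s m \<Delta> (a + a') b = compat1 s m \<Delta> a b + compat1 s m \<Delta> a' b"
    "compat1 s m \<Delta> a (b + b') = compat1 s m \<Delta> a b + compat1 s m \<Delta> a b'"
    "compat2 s m \<Delta> (a + a') b = compat2 s m \<Delta> a b + compat2 s m \<Delta> a' b"
    "compat2 s m \<Delta> a (b + b') = compat2 s m \<Delta> a b + compat2 s m \<Delta> a b'"
    by (simp_all add: compat1_def compat2_def \<Delta> m tmap_add L linear_ident vs l algebra_simps)
qed

lemma defect_biadditive:
  assumes "bilin s s s m" "linear_to_tensor s s s \<Delta>"
  shows "defect1 s m \<Delta> (a + a') (b + b') =
      defect1 s m \<Delta> a b + defect1 s m \<Delta> a b' + defect1 s m \<Delta> a' b + defect1 s m \<Delta> a' b'"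
    and "defect2 s m \<Delta> (a + a') (b + b') =
      defect2 s m \<Delta> a b + defect2 s m \<Delta> a b' + defect2 s m \<Delta> a' b + defect2 s m \<Delta> a' b'"
  by (simp_all add: defect1_def defect2_def compat_biadditive[OF assms] tau_add tau_diff algebra_simps)

lemma defect_mem:
  assumes "bilin s s s m" "linear_to_tensor s s s \<Delta>"
  shows "defect1 s m \<Delta> a b \<in> tensor_space s s" "defect2 s m \<Delta> a b \<in> tensor_space s s"
  unfolding defect1_def defect2_def
  by (intro tensor_space_add tensor_space_diff tau_mem compat_mem[OF assms])+

section \<open>Tensors over a direct sum\<close>

lemma sum_scale_linear:
  assumes "vector_space sA" "vector_space sV"
  shows "Vector_Spaces.linear (sum_scale sA sV) sA fst" "Vector_Spaces.linear (sum_scale sA sV) sV snd"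
    "Vector_Spaces.linear sA (sum_scale sA sV) (\<lambda>a. (a, 0))"
    "Vector_Spaces.linear sV (sum_scale sA sV) (\<lambda>x. (0, x))"
proof -
  interpret A: vector_space sA by fact
  interpret V: vector_space sV by fact
  have "vector_space (sum_scale sA sV)"
    by unfold_locales
      (auto simp: sum_scale_def A.scale_right_distrib A.scale_left_distrib
        V.scale_right_distrib V.scale_left_distrib)
  then show "Vector_Spaces.linear (sum_scale sA sV) sA fst" "Vector_Spaces.linear (sum_scale sA sV) sV snd"
    "Vector_Spaces.linear sA (sum_scale sA sV) (\<lambda>a. (a, 0))"
    "Vector_Spaces.linear sV (sum_scale sA sV) (\<lambda>x. (0, x))"
    unfolding Vector_Spaces.linear_iff using assms by (auto simp: sum_scale_def)
qed

lemma vector_space_sum_scale: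
  "vector_space sA \<Longrightarrow> vector_space sV \<Longrightarrow> vector_space (sum_scale sA sV)"
  using linear_vector_spaces[OF sum_scale_linear(1)] by blast

lemma tensor_sum_decomp:
  fixes T :: "('k::field, 'a::ab_group_add \<times> 'v::ab_group_add, 'a \<times> 'v) tensor"
  assumes "vector_space sA" "vector_space sV"
    and "T \<in> tensor_space (sum_scale sA sV) (sum_scale sA sV)"
  shows "T = tmap (sum_scale sA sV) (sum_scale sA sV) (\<lambda>a. (a, 0)) (\<lambda>a. (a, 0)) (tmap sA sA fst fst T)
    + tmap (sum_scale sA sV) (sum_scale sA sV) (\<lambda>x. (0, x)) (\<lambda>x. (0, x)) (tmap sV sV snd snd T)
    + tmap (sum_scale sA sV) (sum_scale sA sV) (\<lambda>a. (a, 0)) (\<lambda>x. (0, x)) (tmap sA sV fst snd T)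
    + tmap (sum_scale sA sV) (sum_scale sA sV) (\<lambda>x. (0, x)) (\<lambda>a. (a, 0)) (tmap sV sA snd fst T)"
proof (rule tensor_ext[OF assms(3) linear_ident[OF vector_space_fun_scale]])
  note L = sum_scale_linear[OF assms(1,2)] vector_space_sum_scale[OF assms(1,2)]
  show "Vector_Spaces.linear fun_scale fun_scale (\<lambda>T.
      tmap (sum_scale sA sV) (sum_scale sA sV) (\<lambda>a. (a, 0)) (\<lambda>a. (a, 0)) (tmap sA sA fst fst T)
    + tmap (sum_scale sA sV) (sum_scale sA sV) (\<lambda>x. (0, x)) (\<lambda>x. (0, x)) (tmap sV sV snd snd T)
    + tmap (sum_scale sA sV) (sum_scale sA sV) (\<lambda>a. (a, 0)) (\<lambda>x. (0, x)) (tmap sA sV fst snd T)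
    + tmap (sum_scale sA sV) (sum_scale sA sV) (\<lambda>x. (0, x)) (\<lambda>a. (a, 0)) (tmap sV sA snd fst T))"
    by (intro linear_add_map linear_form_comp[OF tmap_linear tmap_linear])
  fix u v :: "'a \<times> 'v"
  obtain a x b y where uv: "u = (a, 0) + (0, x)" "v = (b, 0) + (0, y)"
    by (cases u; cases v) auto
  show "tens (sum_scale sA sV) (sum_scale sA sV) u v =
      tmap (sum_scale sA sV) (sum_scale sA sV) (\<lambda>a. (a, 0)) (\<lambda>a. (a, 0)) (tmap sA sA fst fst (tens (sum_scale sA sV) (sum_scale sA sV) u v))
    + tmap (sum_scale sA sV) (sum_scale sA sV) (\<lambda>x. (0, x)) (\<lambda>x. (0, x)) (tmap sV sV snd snd (tens (sum_scale sA sV) (sum_scale sA sV) u v))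
    + tmap (sum_scale sA sV) (sum_scale sA sV) (\<lambda>a. (a, 0)) (\<lambda>x. (0, x)) (tmap sA sV fst snd (tens (sum_scale sA sV) (sum_scale sA sV) u v))
    + tmap (sum_scale sA sV) (sum_scale sA sV) (\<lambda>x. (0, x)) (\<lambda>a. (a, 0)) (tmap sV sA snd fst (tens (sum_scale sA sV) (sum_scale sA sV) u v))"
    unfolding tmap_tens[OF L(1) L(1)] tmap_tens[OF L(1) L(2)] tmap_tens[OF L(2) L(1)] tmap_tens[OF L(2) L(2)]
      tmap_tens[OF L(3) L(3)] tmap_tens[OF L(3) L(4)] tmap_tens[OF L(4) L(3)] tmap_tens[OF L(4) L(4)]
    unfolding uv tens_add_left[OF L(5,5)] tens_add_right[OF L(5,5)]
    by (simp add: algebra_simps)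
qed

lemma tensor_sum_eq_0_iff:
  fixes T :: "('k::field, 'a::ab_group_add \<times> 'v::ab_group_add, 'a \<times> 'v) tensor"
  assumes "vector_space sA" "vector_space sV"
    and "T \<in> tensor_space (sum_scale sA sV) (sum_scale sA sV)"
  shows "T = 0 \<longleftrightarrow> tmap sA sA fst fst T = 0 \<and> tmap sA sV fst snd T = 0 \<and>
    tmap sV sA snd fst T = 0 \<and> tmap sV sV snd snd T = 0"
  using tensor_sum_decomp[OF assms] by (auto simp: tmap_zero)

section \<open>Components of the compatibility conditions of the unified biproduct\<close>

locale extending_datum = unified_biproduct sA multA comultA sV D
  for sA :: "'k::field \<Rightarrow> 'a::ab_group_add \<Rightarrow> 'a"
    and multA (infixl "\<cdot>" 70)
    and comultA ("\<Delta>\<^sub>A")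
    and sV :: "'k \<Rightarrow> 'v::ab_group_add \<Rightarrow> 'v"
    and D :: "('k, 'a, 'v) extending_maps" (structure) +
  assumes bialgebra: "anti_flexible_bialgebra sA multA comultA"
    and space: "vector_space sV"
    and datum: "extending_datum_II sA sV D"
    and algebra_E: "anti_flexible_algebra (sum_scale sA sV) multE"
    and coalgebra_E: "anti_flexible_coalgebra (sum_scale sA sV) comultE"
begin

abbreviation "sE \<equiv> sum_scale sA sV"

lemma bilinear:
  "bilin sA sA sA (\<cdot>)" "bilin sV sA sA (\<rightharpoonup>)" "bilin sA sV sA (\<leftharpoonup>)" "bilin sV sA sV (\<triangleleft>)"
  "bilin sA sV sV (\<triangleright>)" "bilin sV sV sA \<sigma>" "bilin sV sV sV (\<cdot>\<^sub>V)" "bilin sE sE sE multE"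
  using bialgebra datum algebra_E
  unfolding anti_flexible_bialgebra_def anti_flexible_algebra_def extending_datum_II_def by blast+

lemma linear_tensor:
  "linear_to_tensor sA sA sA \<Delta>\<^sub>A" "linear_to_tensor sV sV sV \<Delta>\<^sub>V" "linear_to_tensor sV sA sV \<rho>"
  "linear_to_tensor sV sV sA \<gamma>" "linear_to_tensor sV sA sA \<Q>" "linear_to_tensor sE sE sE comultE"
  using bialgebra datum coalgebra_E
  unfolding anti_flexible_bialgebra_def anti_flexible_coalgebra_def extending_datum_II_def by blast+

lemma spaces: "vector_space sA" "vector_space sV" "vector_space sE"
  using bialgebra space vector_space_sum_scale
  unfolding anti_flexible_bialgebra_def anti_flexible_algebra_def by blast+

lemmas lin = bilinear[THEN bilin_linear(1)] bilinear[THEN bilin_linear(2)]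
  sum_scale_linear[OF spaces(1,2)] spaces[THEN linear_ident]

lemmas zeros = bilinear[THEN bilin_linear(1), THEN linear_zero] bilinear[THEN bilin_linear(2), THEN linear_zero]
  linear_tensor[unfolded linear_to_tensor_def, THEN conjunct1, THEN linear_zero]

lemmas mem = linear_tensor[unfolded linear_to_tensor_def, THEN conjunct2, THEN spec]

lemma multE_pair: "multE (a, x) (b, y) = (a \<cdot> b + x \<rightharpoonup> b + a \<leftharpoonup> y + \<sigma> x y, x \<cdot>\<^sub>V y + x \<triangleleft> b + a \<triangleright> y)"
  by (simp add: multE_def)

lemma comultE_pair: "comultE (a, x) = tmap sE sE (\<lambda>a. (a, 0)) (\<lambda>a. (a, 0)) (\<Delta>\<^sub>A a)
     + tmap sE sE (\<lambda>x. (0, x)) (\<lambda>x. (0, x)) (\<Delta>\<^sub>V x) + tmap sE sE (\<lambda>a. (a, 0)) (\<lambda>x. (0, x)) (\<rho> x)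
     + tmap sE sE (\<lambda>x. (0, x)) (\<lambda>a. (a, 0)) (\<gamma> x) + tmap sE sE (\<lambda>a. (a, 0)) (\<lambda>a. (a, 0)) (\<Q> x)"
  by (simp add: comultE_def Let_def)

lemmas component_simps = defect1_def defect2_def compat1_def compat2_def multE_pair comultE_pair
  sw_tens_eq_tmap tmap_add tmap_diff tmap_tau tmap_tmap tmap_zero
  mem[THEN tmap_zero_left[rotated 2]] mem[THEN tmap_zero_right[rotated 2]] tmap_ident
  tau_add tau_diff tau_zero tau_tau lin zeros mem spaces

abbreviation "\<D>1 \<equiv> defect1 sE multE comultE"
abbreviation "\<D>2 \<equiv> defect2 sE multE comultE"

lemma F1_iff: "F1 \<longleftrightarrow> (\<forall>x y. tmap sA sV fst snd (\<D>1 (0, x) (0, y)) = 0)"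
  unfolding F1_def Let_def
  by (intro arg_cong[where f=All] ext, rule eq_iff_diff) (simp add: component_simps algebra_simps)

lemma F2_iff: "F2 \<longleftrightarrow> (\<forall>b x. tmap sA sA fst fst (\<D>1 (0, x) (b, 0)) = 0)"
  unfolding F2_def Let_def
  by (intro arg_cong[where f=All] ext, rule eq_iff_diff) (simp add: component_simps algebra_simps)

lemma F3_iff: "F3 \<longleftrightarrow> (\<forall>a y. tmap sV sV snd snd (\<D>1 (a, 0) (0, y)) = 0)"
  unfolding F3_def Let_def
  by (intro arg_cong[where f=All] ext, rule eq_iff_diff) (simp add: component_simps algebra_simps)

lemma F4_iff: "F4 \<longleftrightarrow> (\<forall>x y. tmap sA sA fst fst (\<D>1 (0, x) (0, y)) = 0)"
  unfolding F4_def Let_def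
  by (intro arg_cong[where f=All] ext, rule eq_iff_diff) (simp add: component_simps algebra_simps)

lemma F5_iff: "F5 \<longleftrightarrow> (\<forall>b x. tmap sV sA snd fst (\<D>1 (0, x) (b, 0)) = 0)"
  unfolding F5_def Let_def
  by (intro arg_cong[where f=All] ext, rule eq_iff_diff) (simp add: component_simps algebra_simps)

lemma F6_iff: "F6 \<longleftrightarrow> (\<forall>b x. tmap sA sV fst snd (\<D>1 (0, x) (b, 0)) = 0)"
  unfolding F6_def Let_def
  by (intro arg_cong[where f=All] ext, rule eq_iff_diff) (simp add: component_simps algebra_simps)

lemma F7_iff: "F7 \<longleftrightarrow> (\<forall>b x. tmap sV sA snd fst (\<D>2 (0, x) (b, 0)) = 0)"
  unfolding F7_def Let_def
  by (intro arg_cong[where f=All] ext, rule eq_iff_diff) (simp add: component_simps algebra_simps)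

lemma F8_iff: "F8 \<longleftrightarrow> (\<forall>b x. tmap sV sV snd snd (\<D>2 (0, x) (b, 0)) = 0)"
  unfolding F8_def Let_def
  by (intro arg_cong[where f=All] ext, rule arg_cong[where f="\<lambda>t. t = 0"]) (simp add: component_simps algebra_simps)

lemma F9_iff: "F9 \<longleftrightarrow> (\<forall>x y. tmap sV sA snd fst (\<D>2 (0, x) (0, y)) = 0)"
  unfolding F9_def Let_def
  by (intro arg_cong[where f=All] ext, rule eq_iff_diff) (simp add: component_simps algebra_simps)

lemma F10_iff: "F10 \<longleftrightarrow> (\<forall>b x. tmap sA sA fst fst (\<D>2 (0, x) (b, 0)) = 0)"
  unfolding F10_def Let_def
  by (intro arg_cong[where f=All] ext, rule eq_iff_diff) (simp add: component_simps algebra_simps)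

lemma F11_iff: "F11 \<longleftrightarrow> (\<forall>x y. tmap sA sA fst fst (\<D>2 (0, x) (0, y)) = 0)"
  unfolding F11_def Let_def
  by (intro arg_cong[where f=All] ext, rule eq_iff_diff) (simp add: component_simps algebra_simps)

lemma F12_iff: "F12 \<longleftrightarrow> (\<forall>x y. tmap sV sV snd snd (\<D>1 (0, x) (0, y)) = 0)"
  unfolding F12_def Let_def
  by (intro arg_cong[where f=All] ext, rule eq_iff_diff) (simp add: component_simps algebra_simps)

lemma F13_iff: "F13 \<longleftrightarrow> (\<forall>x y. tmap sV sV snd snd (\<D>2 (0, x) (0, y)) = 0)"
  unfolding F13_def Let_def
  by (intro arg_cong[where f=All] ext, rule arg_cong[where f="\<lambda>t. t = 0"]) (simp add: component_simps algebra_simps)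

lemma defect_eq_0_iff:
  "\<D>1 p q = 0 \<longleftrightarrow> tmap sA sA fst fst (\<D>1 p q) = 0 \<and> tmap sA sV fst snd (\<D>1 p q) = 0 \<and>
     tmap sA sV fst snd (\<D>1 q p) = 0 \<and> tmap sV sV snd snd (\<D>1 p q) = 0"
  "\<D>2 p q = 0 \<longleftrightarrow> tmap sA sA fst fst (\<D>2 p q) = 0 \<and>
     tmap sV sA snd fst (\<D>2 p q) = 0 \<and> tmap sV sV snd snd (\<D>2 p q) = 0"
proof -
  note mem_E = defect_mem[OF bilinear(8) linear_tensor(6)]
  have "tmap sV sA snd fst (\<D>1 p q) = tau (tmap sA sV fst snd (\<D>1 q p))"
    by (simp add: defect1_def tmap_add tmap_tau tau_add tau_tau add.commute)
  then show "\<D>1 p q = 0 \<longleftrightarrow> tmap sA sA fst fst (\<D>1 p q) = 0 \<and> tmap sA sV fst snd (\<D>1 p q) = 0 \<and>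
     tmap sA sV fst snd (\<D>1 q p) = 0 \<and> tmap sV sV snd snd (\<D>1 p q) = 0"
    using tensor_sum_eq_0_iff[OF spaces(1,2) mem_E(1)[of p q]] by (auto simp: tau_eq_0_iff)
  have "tmap sV sA snd fst (\<D>2 p q) = - tau (tmap sA sV fst snd (\<D>2 p q))"
    by (simp add: defect2_def tmap_diff tmap_tau tau_diff tau_tau)
  then show "\<D>2 p q = 0 \<longleftrightarrow> tmap sA sA fst fst (\<D>2 p q) = 0 \<and>
     tmap sV sA snd fst (\<D>2 p q) = 0 \<and> tmap sV sV snd snd (\<D>2 p q) = 0"
    using tensor_sum_eq_0_iff[OF spaces(1,2) mem_E(2)[of p q]] by (auto simp: tau_eq_0_iff)
qed

lemma inclusion_hom:
  "algebra_hom sA (\<cdot>) sE multE (\<lambda>a. (a, 0))" "coalgebra_hom sA \<Delta>\<^sub>A sE comultE (\<lambda>a. (a, 0))"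
  by (simp_all add: algebra_hom_def coalgebra_hom_def multE_pair comultE_pair lin zeros tmap_zero)

lemma defect_inclusion: "\<D>1 (a, 0) (b, 0) = 0" "\<D>2 (a, 0) (b, 0) = 0"
  using defect_hom[OF bilinear(1,8) inclusion_hom, of a b] bialgebra
  by (simp_all add: anti_flexible_bialgebra_iff tmap_zero)

lemma defect_eq_0_split:
  "(\<forall>p q. \<D>1 p q = 0) \<longleftrightarrow> (\<forall>b x. \<D>1 (0, x) (b, 0) = 0) \<and> (\<forall>x y. \<D>1 (0, x) (0, y) = 0)"
    (is "?l1 \<longleftrightarrow> ?r1")
  "(\<forall>p q. \<D>2 p q = 0) \<longleftrightarrow> (\<forall>b x. \<D>2 (0, x) (b, 0) = 0) \<and> (\<forall>x y. \<D>2 (0, x) (0, y) = 0)"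
    (is "?l2 \<longleftrightarrow> ?r2")
proof -
  have add1: "\<D>1 (a, x) (b, y) = tau (\<D>1 (0, y) (a, 0)) + \<D>1 (0, x) (b, 0) + \<D>1 (0, x) (0, y)" for a x b y
    using defect_biadditive(1)[OF bilinear(8) linear_tensor(6), of "(a, 0)" "(0, x)" "(b, 0)" "(0, y)"]
    by (simp add: defect_inclusion defect1_swap[symmetric])
  have add2: "\<D>2 (a, x) (b, y) = - \<D>2 (0, y) (a, 0) + \<D>2 (0, x) (b, 0) + \<D>2 (0, x) (0, y)" for a x b y
    using defect_biadditive(2)[OF bilinear(8) linear_tensor(6), of "(a, 0)" "(0, x)" "(b, 0)" "(0, y)"]
    by (simp add: defect_inclusion defect2_swap[symmetric])
  show "?l1 \<longleftrightarrow> ?r1"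
  proof
    assume ?r1
    then show ?l1 unfolding split_paired_All by (subst add1) (simp add: tau_zero)
  qed blast
  show "?l2 \<longleftrightarrow> ?r2"
  proof
    assume ?r2
    then show ?l2 unfolding split_paired_All by (subst add2) simp
  qed blast
qed

lemma bialgebra_iff_compatible: "anti_flexible_bialgebra sE multE comultE \<longleftrightarrow> compatible"
proof -
  have F3: "F3 \<longleftrightarrow> (\<forall>b x. tmap sV sV snd snd (\<D>1 (0, x) (b, 0)) = 0)"
    unfolding F3_iff by (subst defect1_swap) (auto simp: tmap_tau tau_eq_0_iff)
  have F5: "F5 \<longleftrightarrow> (\<forall>b x. tmap sA sV fst snd (\<D>1 (b, 0) (0, x)) = 0)"
    unfolding F5_iff by (subst defect1_swap) (auto simp: tmap_tau tau_eq_0_iff)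
  have "(\<forall>b x. \<D>1 (0, x) (b, 0) = 0) \<longleftrightarrow> F2 \<and> F3 \<and> F5 \<and> F6"
    unfolding F2_iff F3 F5 F6_iff defect_eq_0_iff(1)[of "(0, _)" "(_, 0)"] by blast
  moreover have "(\<forall>x y. \<D>1 (0, x) (0, y) = 0) \<longleftrightarrow> F1 \<and> F4 \<and> F12"
    unfolding F1_iff F4_iff F12_iff defect_eq_0_iff(1)[of "(0, _)" "(0, _)"] by blast
  moreover have "(\<forall>b x. \<D>2 (0, x) (b, 0) = 0) \<longleftrightarrow> F7 \<and> F8 \<and> F10"
    unfolding F7_iff F8_iff F10_iff defect_eq_0_iff(2)[of "(0, _)" "(_, 0)"] by blast
  moreover have "(\<forall>x y. \<D>2 (0, x) (0, y) = 0) \<longleftrightarrow> F9 \<and> F11 \<and> F13"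
    unfolding F9_iff F11_iff F13_iff defect_eq_0_iff(2)[of "(0, _)" "(0, _)"] by blast
  ultimately show ?thesis
    unfolding anti_flexible_bialgebra_iff compatible_def defect_eq_0_split
    using algebra_E coalgebra_E by blast
qed

end

section \<open>Transport of bialgebra structures\<close>

lemma linear_fun_scale:
  "Vector_Spaces.linear fun_scale fun_scale (fun_scale c :: ('b \<Rightarrow> 'k::field) \<Rightarrow> 'b \<Rightarrow> 'k)"
  unfolding Vector_Spaces.linear_iff
  by (simp add: vector_space_fun_scale) (simp add: fun_scale_def fun_eq_iff algebra_simps)

lemma linear_sw_parameter:
  assumes "vector_space s" and t: "t \<in> tensor_space r1 r2" and F: "\<And>y. bilin r1 r2 fun_scale (F y)"
    and lin: "\<And>u v. Vector_Spaces.linear s fun_scale (\<lambda>y. F y u v)"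
  shows "Vector_Spaces.linear s fun_scale (\<lambda>y. sw t (F y))"
proof -
  have "sw t (F (y + y')) = sw t (F y) + sw t (F y')" for y y'
    by (rule tensor_ext[OF t sw_linear linear_add_map[OF sw_linear sw_linear]])
      (simp add: sw_tens[OF F] linear_add[OF lin])
  moreover have "sw t (F (s c y)) = fun_scale c (sw t (F y))" for c y
    by (rule tensor_ext[OF t sw_linear linear_form_comp[OF sw_linear linear_fun_scale]])
      (use lin in \<open>simp add: sw_tens[OF F] Vector_Spaces.linear_iff\<close>)
  ultimately show ?thesis
    unfolding Vector_Spaces.linear_iff using assms(1) vector_space_fun_scale by blast
qed

lemma trilin_form_comp:
  assumes "Vector_Spaces.linear s s' f"
  shows "trilin s (*) (\<lambda>u v w. tens3 s' (f u) (f v) (f w) B)"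
proof -
  have "trilin s' fun_scale (tens3 s')" using linear_vector_spaces[OF assms] by (simp add: trilin_tens3)
  then have "Vector_Spaces.linear s' fun_scale (\<lambda>u. tens3 s' u v w)"
    "Vector_Spaces.linear s' fun_scale (\<lambda>u. tens3 s' v u w)"
    "Vector_Spaces.linear s' fun_scale (\<lambda>u. tens3 s' v w u)" for v w
    unfolding trilin_def by blast+
  note this[THEN linear_form_comp[OF _ linear_evaluation[of B]]]
  then show ?thesis
    unfolding trilin_def using linear_form_comp[OF assms] by blast
qed

lemma coassociator_hom:
  assumes f: "coalgebra_hom s \<Delta> s' \<Delta>' f" and \<Delta>': "linear_to_tensor s' s' s' \<Delta>'"
  shows "coassociator s' \<Delta>' (f a) =
    (\<lambda>B. coassociator s \<Delta> a (\<lambda>u v w. tens3 s' (f u) (f v) (f w) B))"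
proof -
  have lin: "Vector_Spaces.linear s s' f" and cohom: "\<And>a. \<Delta>' (f a) = tmap s' s' f f (\<Delta> a)"
    using f by (auto simp: coalgebra_hom_def)
  have s': "vector_space s'" using linear_vector_spaces[OF lin] by simp
  have lin\<Delta>: "Vector_Spaces.linear s' fun_scale \<Delta>'" and mem: "\<And>e. \<Delta>' e \<in> tensor_space s' s'"
    using \<Delta>' by (auto simp: linear_to_tensor_def)
  have tri: "Vector_Spaces.linear s' fun_scale (\<lambda>u. tens3 s' u v w)"
    "Vector_Spaces.linear s' fun_scale (\<lambda>u. tens3 s' v u w)"
    "Vector_Spaces.linear s' fun_scale (\<lambda>u. tens3 s' v w u)" for v w
    using trilin_tens3[OF s'] by (simp_all add: trilin_def)
  have bil: "bilin s' s' fun_scale (\<lambda>p q. tens3 s' p q e)" "bilin s' s' fun_scale (\<lambda>p q. tens3 s' e p q)" for e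
    using tri by (simp_all add: bilin_def)
  have bil1: "bilin s' s' fun_scale (\<lambda>e1 e2. sw (\<Delta>' e1) (\<lambda>p q. tens3 s' p q e2))"
    unfolding bilin_def
    by (intro conjI allI linear_form_comp[OF lin\<Delta> sw_linear] linear_sw_parameter[OF s' mem bil(1)] tri)
  have bil2: "bilin s' s' fun_scale (\<lambda>e1 e2. sw (\<Delta>' e2) (\<lambda>p q. tens3 s' e1 p q))"
    unfolding bilin_def
    by (intro conjI allI linear_form_comp[OF lin\<Delta> sw_linear] linear_sw_parameter[OF s' mem bil(2)] tri)
  have "tens3 s u v w (\<lambda>u v w. tens3 s' (f u) (f v) (f w) B) = tens3 s' (f u) (f v) (f w) B" for u v w B
    using trilin_form_comp[OF lin] by (simp add: tens3_def[of s])
  then show ?thesis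
    unfolding coassociator_def cohom sw_tmap[OF bil1] sw_tmap[OF bil2] sw_tmap[OF bil(1)] sw_tmap[OF bil(2)]
    by (simp add: sw_def fun_eq_iff)
qed

lemma tau13_hom:
  "tau13 (\<lambda>B. T (\<lambda>u v w. tens3 s' (f u) (f v) (f w) B)) = (\<lambda>B. tau13 T (\<lambda>u v w. tens3 s' (f u) (f v) (f w) B))"
proof -
  have "tens3 s' u v w (\<lambda>u v w. B w v u) = tens3 s' w v u B" for u v w B
    using fun_cong[OF tau13_tens3[of s' u v w]] by (simp add: tau13_def)
  then have "(\<lambda>u v w. tens3 s' (f u) (f v) (f w) (\<lambda>u v w. B w v u)) =
      (\<lambda>u v w. tens3 s' (f w) (f v) (f u) B)" for B
    by blast
  then show ?thesis by (simp add: tau13_def)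
qed

lemma bialgebra_transport:
  assumes E: "anti_flexible_bialgebra sE mE dE"
    and \<phi>: "Vector_Spaces.linear sF sE \<phi>" and \<psi>: "Vector_Spaces.linear sE sF \<psi>"
    and inv: "\<And>p. \<psi> (\<phi> p) = p" "\<And>e. \<phi> (\<psi> e) = e"
  defines "m \<equiv> \<lambda>p q. \<psi> (mE (\<phi> p) (\<phi> q))" and "d \<equiv> \<lambda>p. tmap sF sF \<psi> \<psi> (dE (\<phi> p))"
  shows "anti_flexible_bialgebra sF m d"
    and "algebra_hom sF m sE mE \<phi>" and "coalgebra_hom sF d sE dE \<phi>"
    and "algebra_hom sE mE sF m \<psi>" and "coalgebra_hom sE dE sF d \<psi>"
proof -
  have sE: "vector_space sE" "vector_space sF" using linear_vector_spaces[OF \<phi>] by auto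
  have mE: "bilin sE sE sE mE" and flex: "mE (mE a b) c - mE a (mE b c) = mE (mE c b) a - mE c (mE b a)" for a b c
    using E by (auto simp: anti_flexible_bialgebra_def anti_flexible_algebra_def)
  have dE: "linear_to_tensor sE sE sE dE" and coflex: "coassociator sE dE e = tau13 (coassociator sE dE e)" for e
    using E by (auto simp: anti_flexible_bialgebra_def anti_flexible_coalgebra_def)
  have linE: "Vector_Spaces.linear sE fun_scale dE" and memE: "dE e \<in> tensor_space sE sE" for e
    using dE by (auto simp: linear_to_tensor_def)
  have m: "bilin sF sF sF m"
    using bilin_comp[OF mE \<phi> \<phi>] unfolding m_def bilin_def by (auto intro: linear_form_comp[OF _ \<psi>])
  have d: "linear_to_tensor sF sF sF d"
    unfolding linear_to_tensor_def d_def
    by (intro conjI allI linear_form_comp[OF linear_form_comp[OF \<phi> linE] tmap_linear] tmap_mem[OF \<psi> \<psi> memE])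
  show hom: "algebra_hom sE mE sF m \<psi>" "coalgebra_hom sE dE sF d \<psi>"
    using \<psi> by (simp_all add: algebra_hom_def coalgebra_hom_def m_def d_def inv)
  show "algebra_hom sF m sE mE \<phi>"
    using \<phi> by (simp add: algebra_hom_def m_def inv)
  show "coalgebra_hom sF d sE dE \<phi>"
    using \<phi> by (simp add: coalgebra_hom_def d_def tmap_tmap inv tmap_ident sE memE)
  have "m (m p q) r - m p (m q r) = m (m r q) p - m r (m q p)" for p q r
  proof -
    have diff: "\<psi> (a - b) = \<psi> a - \<psi> b" for a b
      using module_hom.diff[OF \<psi>[THEN module_hom_iff_linear[THEN iffD2]]] .
    show ?thesis unfolding m_def inv diff[symmetric] by (simp only: flex)
  qed
  then have alg: "anti_flexible_algebra sF m"
    using sE m by (simp add: anti_flexible_algebra_def)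
  have "coassociator sF d (\<psi> e) = tau13 (coassociator sF d (\<psi> e))" for e
    unfolding coassociator_hom[OF hom(2) d] tau13_hom using coflex[of e] by simp
  from this[of "\<phi> _"] have coalg: "anti_flexible_coalgebra sF d"
    using sE d by (simp add: anti_flexible_coalgebra_def inv)
  have "defect1 sF m d (\<psi> (\<phi> p)) (\<psi> (\<phi> q)) = 0" "defect2 sF m d (\<psi> (\<phi> p)) (\<psi> (\<phi> q)) = 0" for p q
    using E unfolding defect_hom[OF mE m hom] by (simp_all add: anti_flexible_bialgebra_iff tmap_zero)
  then show "anti_flexible_bialgebra sF m d"
    using alg coalg by (simp add: anti_flexible_bialgebra_iff inv)
qed

lemma extending_datum_exists:
  fixes m :: "'a::ab_group_add \<times> 'v::ab_group_add \<Rightarrow> 'a \<times> 'v \<Rightarrow> 'a \<times> 'v"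
    and d :: "'a \<times> 'v \<Rightarrow> ('k::field, 'a \<times> 'v, 'a \<times> 'v) tensor"
  assumes vs: "vector_space sA" "vector_space sV"
    and m: "bilin (sum_scale sA sV) (sum_scale sA sV) (sum_scale sA sV) m"
    and d: "linear_to_tensor (sum_scale sA sV) (sum_scale sA sV) (sum_scale sA sV) d"
    and incl: "algebra_hom sA mA (sum_scale sA sV) m (\<lambda>a. (a, 0))"
      "coalgebra_hom sA dA (sum_scale sA sV) d (\<lambda>a. (a, 0))"
  shows "\<exists>D. extending_datum_II sA sV D \<and> unified_biproduct.multE mA D = m \<and>
    unified_biproduct.comultE sA dA sV D = d"
proof -
  let ?s = "sum_scale sA sV"
  note L = sum_scale_linear[OF vs]
  define D :: "('k, 'a, 'v) extending_maps" where
    "D = \<lparr>lharp = (\<lambda>x b. fst (m (0, x) (b, 0))), rharp = (\<lambda>a y. fst (m (a, 0) (0, y))),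
      ltri = (\<lambda>x b. snd (m (0, x) (b, 0))), rtri = (\<lambda>a y. snd (m (a, 0) (0, y))),
      cocyc = (\<lambda>x y. fst (m (0, x) (0, y))),
      lcoact = (\<lambda>x. tmap sA sV fst snd (d (0, x))), rcoact = (\<lambda>x. tmap sV sA snd fst (d (0, x))),
      cycle = (\<lambda>x. tmap sA sA fst fst (d (0, x))),
      multV = (\<lambda>x y. snd (m (0, x) (0, y))), comultV = (\<lambda>x. tmap sV sV snd snd (d (0, x)))\<rparr>"
  have bil: "bilin r1 r2 r3 (\<lambda>u v. h (m (f u) (g v)))"
    if "Vector_Spaces.linear r1 ?s f" "Vector_Spaces.linear r2 ?s g" "Vector_Spaces.linear ?s r3 h"
    for f g h and r1 :: "'k \<Rightarrow> 'x::ab_group_add \<Rightarrow> 'x" and r2 :: "'k \<Rightarrow> 'y::ab_group_add \<Rightarrow> 'y"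
      and r3 :: "'k \<Rightarrow> 'z::ab_group_add \<Rightarrow> 'z"
    using bilin_comp[OF m that(1,2)] unfolding bilin_def by (auto intro: linear_form_comp[OF _ that(3)])
  have dl: "Vector_Spaces.linear ?s fun_scale d" and dm: "d p \<in> tensor_space ?s ?s" for p
    using d unfolding linear_to_tensor_def by blast+
  have tens: "linear_to_tensor sV r1 r2 (\<lambda>x. tmap r1 r2 f g (d (0, x)))"
    if "Vector_Spaces.linear ?s r1 f" "Vector_Spaces.linear ?s r2 g"
    for f g and r1 :: "'k \<Rightarrow> 'x::ab_group_add \<Rightarrow> 'x" and r2 :: "'k \<Rightarrow> 'y::ab_group_add \<Rightarrow> 'y"
    unfolding linear_to_tensor_def
    by (intro conjI allI linear_form_comp[OF linear_form_comp[OF L(4) dl] tmap_linear] tmap_mem[OF that dm])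
  have "extending_datum_II sA sV D"
    unfolding extending_datum_II_def D_def extending_maps.simps
    by (intro conjI bil tens L)
  moreover have "unified_biproduct.multE mA D (a, x) (b, y) = m (a, x) (b, y)" for a x b y
  proof -
    note l = bilin_linear[OF m, THEN linear_add]
    have "m (a, x) (b, y) = m ((a, 0) + (0, x)) ((b, 0) + (0, y))" by simp
    also have "\<dots> = m (a, 0) (b, 0) + m (0, x) (b, 0) + m (a, 0) (0, y) + m (0, x) (0, y)"
      by (simp only: l add.assoc add.left_commute)
    also have "m (a, 0) (b, 0) = (mA a b, 0)"
      using incl(1) by (simp add: algebra_hom_def)
    finally show ?thesis
      by (simp add: unified_biproduct.multE_def D_def prod_eq_iff algebra_simps)
  qed
  moreover have "unified_biproduct.comultE sA dA sV D (a, x) = d (a, x)" for a x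
  proof -
    have "d (a, x) = d (a, 0) + d (0, x)"
      using linear_add[OF dl, of "(a, 0)" "(0, x)"] by simp
    also have "d (a, 0) = tmap ?s ?s (\<lambda>a. (a, 0)) (\<lambda>a. (a, 0)) (dA a)"
      using incl(2) by (simp add: coalgebra_hom_def)
    also note tensor_sum_decomp[OF vs dm, of "(0, x)"]
    finally show ?thesis
      by (simp add: unified_biproduct.comultE_def D_def Let_def fun_eq_iff algebra_simps)
  qed
  ultimately show ?thesis
    by (intro exI[of _ D]) (simp add: fun_eq_iff)
qed

theorem theorem5p16:
  fixes sA :: "'k::field_char_0 \<Rightarrow> 'a::ab_group_add \<Rightarrow> 'a"
    and mA :: "'a \<Rightarrow> 'a \<Rightarrow> 'a"
    and dA :: "'a \<Rightarrow> ('k, 'a, 'a) tensor"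
    and sV :: "'k \<Rightarrow> 'v::ab_group_add \<Rightarrow> 'v"
  assumes "anti_flexible_bialgebra sA mA dA"
    and "vector_space sV"
  shows "(\<forall>D :: ('k, 'a, 'v) extending_maps. extending_datum_II sA sV D \<longrightarrow>
      (anti_flexible_bialgebra (sum_scale sA sV)
          (unified_biproduct.multE mA D) (unified_biproduct.comultE sA dA sV D) \<longleftrightarrow>
       anti_flexible_algebra (sum_scale sA sV) (unified_biproduct.multE mA D) \<and>
       anti_flexible_coalgebra (sum_scale sA sV) (unified_biproduct.comultE sA dA sV D) \<and>
       unified_biproduct.compatible sA mA dA sV D))
    \<and>
    (\<forall>(sE :: 'k \<Rightarrow> 'e::ab_group_add \<Rightarrow> 'e) mE dE (i :: 'a \<Rightarrow> 'e) (j :: 'v \<Rightarrow> 'e).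
      Vector_Spaces.linear sA sE i \<and> inj i \<and> Vector_Spaces.linear sV sE j \<and> inj j \<and>
      range i \<inter> range j = {0} \<and> (\<forall>e. \<exists>a x. e = i a + j x) \<and>
      anti_flexible_bialgebra sE mE dE \<and>
      algebra_hom sA mA sE mE i \<and> coalgebra_hom sA dA sE dE i \<longrightarrow>
      (\<exists>D :: ('k, 'a, 'v) extending_maps. extending_datum_II sA sV D \<and>
         anti_flexible_bialgebra (sum_scale sA sV)
           (unified_biproduct.multE mA D) (unified_biproduct.comultE sA dA sV D) \<and>
         bij (\<lambda>(a, x). i a + j x) \<and>
         algebra_hom (sum_scale sA sV) (unified_biproduct.multE mA D) sE mE
           (\<lambda>(a, x). i a + j x) \<and>
         coalgebra_hom (sum_scale sA sV) (unified_biproduct.comultE sA dA sV D) sE dE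
           (\<lambda>(a, x). i a + j x)))"
proof (rule conjI; (intro allI impI)?)
  have sA: "vector_space sA"
    using assms(1) by (simp add: anti_flexible_bialgebra_def anti_flexible_algebra_def)
  {
    fix D :: "('k, 'a, 'v) extending_maps"
    assume D: "extending_datum_II sA sV D"
    show "anti_flexible_bialgebra (sum_scale sA sV)
          (unified_biproduct.multE mA D) (unified_biproduct.comultE sA dA sV D) \<longleftrightarrow>
       anti_flexible_algebra (sum_scale sA sV) (unified_biproduct.multE mA D) \<and>
       anti_flexible_coalgebra (sum_scale sA sV) (unified_biproduct.comultE sA dA sV D) \<and>
       unified_biproduct.compatible sA mA dA sV D" (is "?b \<longleftrightarrow> ?a \<and> ?c \<and> ?k")
    proof (cases "?a \<and> ?c")
      case True
      then interpret extending_datum sA mA dA sV D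
        using assms D by (intro extending_datum.intro) simp_all
      show ?thesis using True bialgebra_iff_compatible by blast
    qed (auto simp: anti_flexible_bialgebra_def)
  }
  fix sE :: "'k \<Rightarrow> 'e::ab_group_add \<Rightarrow> 'e" and mE dE and i :: "'a \<Rightarrow> 'e" and j :: "'v \<Rightarrow> 'e"
  assume "Vector_Spaces.linear sA sE i \<and> inj i \<and> Vector_Spaces.linear sV sE j \<and> inj j \<and>
      range i \<inter> range j = {0} \<and> (\<forall>e. \<exists>a x. e = i a + j x) \<and>
      anti_flexible_bialgebra sE mE dE \<and>
      algebra_hom sA mA sE mE i \<and> coalgebra_hom sA dA sE dE i"
  then have i: "Vector_Spaces.linear sA sE i" "inj i" and j: "Vector_Spaces.linear sV sE j" "inj j"
    and meet: "range i \<inter> range j = {0}" and sum: "\<And>e. \<exists>a x. e = i a + j x"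
    and E: "anti_flexible_bialgebra sE mE dE"
    and hom: "algebra_hom sA mA sE mE i" "coalgebra_hom sA dA sE dE i"
    by blast+
  define \<phi> where "\<phi> = (\<lambda>(a, x). i a + j x)"
  note L = sum_scale_linear[OF sA assms(2)]
  have lin: "Vector_Spaces.linear (sum_scale sA sV) sE \<phi>"
    using linear_add_map[OF linear_form_comp[OF L(1) i(1)] linear_form_comp[OF L(2) j(1)]]
    by (simp add: \<phi>_def case_prod_unfold)
  have "inj \<phi>"
  proof (rule injI)
    fix p q :: "'a \<times> 'v" assume eq: "\<phi> p = \<phi> q"
    obtain a x b y where pq: "p = (a, x)" "q = (b, y)" by (cases p; cases q) blast
    have "i (a - b) = i a - i b" "j (y - x) = j y - j x"
      using i(1) j(1) module_hom.diff module_hom_iff_linear by blast+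
    moreover have "i a - i b = j y - j x"
      using eq by (simp add: pq \<phi>_def algebra_simps)
    ultimately have "i (a - b) = j (y - x)" by simp
    then have "i (a - b) = 0" "j (y - x) = 0" using meet by (metis Int_iff rangeI singletonD)+
    then have "a - b = 0" "y - x = 0"
      using injD[OF i(2), of "a - b" 0] injD[OF j(2), of "y - x" 0] linear_zero[OF i(1)] linear_zero[OF j(1)]
      by simp_all
    then show "p = q" by (simp add: pq)
  qed
  moreover have "surj \<phi>"
  proof (rule surjI)
    show "\<phi> (SOME p. \<phi> p = e) = e" for e
      using sum[of e] by (intro someI_ex[of "\<lambda>p. \<phi> p = e"]) (auto simp: \<phi>_def)
  qed
  ultimately have bij: "bij \<phi>" by (simp add: bij_def)
  define \<psi> where "\<psi> = inv \<phi>"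
  have inv: "\<psi> (\<phi> p) = p" "\<phi> (\<psi> e) = e" for p e
    using bij by (simp_all add: \<psi>_def bij_is_inj bij_is_surj surj_f_inv_f)
  have lin': "Vector_Spaces.linear sE (sum_scale sA sV) \<psi>"
    using lin linear_vector_spaces[OF lin] inv unfolding Vector_Spaces.linear_iff by metis
  note T = bialgebra_transport[OF E lin lin' inv]
  let ?m = "\<lambda>p q. \<psi> (mE (\<phi> p) (\<phi> q))"
  let ?d = "\<lambda>p. tmap (sum_scale sA sV) (sum_scale sA sV) \<psi> \<psi> (dE (\<phi> p))"
  have \<phi>i: "\<phi> (a, 0) = i a" for a by (simp add: \<phi>_def linear_zero[OF j(1)])
  then have \<psi>i: "\<psi> (i a) = (a, 0)" for a using inv(1)[of "(a, 0)"] by simp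
  have "\<psi> (mE (i a) (i b)) = (mA a b, 0)" for a b
    using hom(1) \<psi>i[of "mA a b"] by (simp add: algebra_hom_def)
  then have "algebra_hom sA mA (sum_scale sA sV) ?m (\<lambda>a. (a, 0))"
    using L(3) by (simp add: algebra_hom_def \<phi>i)
  moreover have "coalgebra_hom sA dA (sum_scale sA sV) ?d (\<lambda>a. (a, 0))"
    using hom(2) L(3) by (simp add: coalgebra_hom_def \<phi>i tmap_tmap lin' \<psi>i)
  ultimately obtain D where D: "extending_datum_II sA sV D" "unified_biproduct.multE mA D = ?m"
    "unified_biproduct.comultE sA dA sV D = ?d"
    using extending_datum_exists[OF sA assms(2), of ?m ?d mA dA] T(1)
    by (auto simp: anti_flexible_bialgebra_def anti_flexible_algebra_def anti_flexible_coalgebra_def)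
  show "\<exists>D :: ('k, 'a, 'v) extending_maps. extending_datum_II sA sV D \<and>
         anti_flexible_bialgebra (sum_scale sA sV)
           (unified_biproduct.multE mA D) (unified_biproduct.comultE sA dA sV D) \<and>
         bij (\<lambda>(a, x). i a + j x) \<and>
         algebra_hom (sum_scale sA sV) (unified_biproduct.multE mA D) sE mE
           (\<lambda>(a, x). i a + j x) \<and>
         coalgebra_hom (sum_scale sA sV) (unified_biproduct.comultE sA dA sV D) sE dE
           (\<lambda>(a, x). i a + j x)"
    unfolding \<phi>_def[symmetric] using D T(1,2,3) bij by (intro exI[of _ D]) simp
qed

end
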